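(* Let $\varepsilon=\varepsilon(n)$, $\beta=\beta(n)$, $\gamma=\gamma(n)$ take values in $(0,1)$ and satisfy $\beta \le \left(\frac{\varepsilon}{100}\right)^{2.5}$ and $\varepsilon = \Omega\!\left(\frac{(\log n)^{6/5}}{n^{1/5}}\right)$. Then there exists a gossip algorithm using messages of size $O(\log n)$ that, in the presence of a $\beta$-strong adversary, solves the $\varepsilon$-approximate mean problem with $M$-bounded values with correctness level $\gamma$ with high probability, in $$O\!\left(\log\frac1\varepsilon + \log\frac{1}{\gamma+\beta} + \frac{\log(1/\gamma)}{\log(1/\beta)}\right)$$ rounds.
   Context: Gossip model: there are $n$ nodes, every pair of which can communicate (complete graph). Communication proceeds in synchronous rounds; in each round every node chooses a node uniformly at random (possibly itself) and either pushes a message to it or pulls a message from it. $\beta$-strong adversary: at the beginning of each round the adversary chooses at most $\beta n$ nodes; any message pulled from or pushed to these nodes in that round can be replaced arbitrarily by the adversary. The adversary does not know in advance the random choice of communication partners in the current round, but otherwise is unrestricted (unbounded computational power, knows the full history). $\varepsilon$-approximate mean problem with $M$-bounded values: each node initially holds a value in $[0,M]$, where $M$ is polynomially bounded in $n$; a node's output is correct if it differs from the mean of the $n$ initial values by at most $\varepsilon M$. Correctness level $\gamma$: upon termination at most $\gamma n$ nodes hold (output) an incorrect value. "With high probability" means with probability $1-n^{-\Omega(1)}$. *)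

theory Defs
  imports "HOL-Probability.Probability" "HOL-Library.Landau_Symbols"
begin

type_synonym message = "bool list"

datatype action = Push message | Pull

text \<open>
  What a node learns in one round: its private coin, the reply to its pull (\<open>None\<close> if it pushed
  in this round), and the messages pushed to it. Nodes are anonymous: a node sees neither its own
  name nor the names of the nodes it communicates with.
\<close>
type_synonym round_log = "nat \<times> message option \<times> message multiset"

text \<open>
  The local view of a node is its initial value followed by the logs of all past rounds, most
  recent first. Letting an algorithm act on complete views avoids fixing a type of local states:
  any local state is a function of the view.
\<close>
type_synonym view = "real \<times> round_log list"

text \<open>
  The common program of all nodes. At the start of a round each node draws a private coin from
  \<open>coin_dist\<close> (return a point mass for an algorithm without private randomness). Its
  view and coin determine whether it pushes or pulls and what it answers to the nodes pulling
  from it. All nodes stop after \<open>rounds\<close> rounds.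
\<close>
record gossip_algorithm =
  rounds :: nat
  coin_dist :: "view \<Rightarrow> nat pmf"
  act :: "view \<Rightarrow> nat \<Rightarrow> action"
  answer :: "view \<Rightarrow> nat \<Rightarrow> message"
  result :: "view \<Rightarrow> real"

definition message_size_le :: "gossip_algorithm \<Rightarrow> nat \<Rightarrow> bool" where
  "message_size_le A L \<longleftrightarrow>
     (\<forall>w c. length (answer A w c) \<le> L \<and> (\<forall>m. act A w c = Push m \<longrightarrow> length m \<le> L))"

text \<open>
  The history before the partners of the current round are drawn: the partner choices of all past
  rounds (most recent first), the views of all nodes, and the private coins of the current round.
\<close>
type_synonym history = "(nat \<Rightarrow> nat) list \<times> (nat \<Rightarrow> view) \<times> (nat \<Rightarrow> nat)"

text \<open>
  An adaptive strategy. The attacked nodes are chosen from the history alone, so independently of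
  the partner choices of the current round; the replacement messages may in addition depend on
  those choices. Every node initiates exactly one message transfer per round, so the replacements
  are indexed by the initiating node. A randomised strategy is a mixture of deterministic ones;
  hence a success probability guaranteed against all deterministic strategies holds against
  randomised ones as well.
\<close>
record adversary =
  attacked :: "history \<Rightarrow> nat set"
  forged :: "history \<Rightarrow> (nat \<Rightarrow> nat) \<Rightarrow> nat \<Rightarrow> message"

definition strong_adversary :: "nat \<Rightarrow> real \<Rightarrow> adversary \<Rightarrow> bool" where
  "strong_adversary n \<beta> D \<longleftrightarrow>
     (\<forall>h. attacked D h \<subseteq> {..<n} \<and> real (card (attacked D h)) \<le> \<beta> * real n)"

text \<open>
  Message transfer in one round, with nodes \<open>{..<n}\<close>, views \<open>w\<close>, coins \<open>c\<close>, partners \<open>p\<close>,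
  attacked nodes \<open>B\<close> and replacements \<open>f\<close>. A transfer initiated by \<open>v\<close> is replaced iff the
  partner \<open>p v\<close> is attacked, whether \<open>v\<close> pushes or pulls.
\<close>
definition reply ::
  "gossip_algorithm \<Rightarrow> (nat \<Rightarrow> view) \<Rightarrow> (nat \<Rightarrow> nat) \<Rightarrow> (nat \<Rightarrow> nat) \<Rightarrow> nat set \<Rightarrow>
   (nat \<Rightarrow> message) \<Rightarrow> nat \<Rightarrow> message option" where
  "reply A w c p B f v =
     (case act A (w v) (c v) of
        Push m \<Rightarrow> None
      | Pull \<Rightarrow> Some (if p v \<in> B then f v else answer A (w (p v)) (c (p v))))"

definition pushed ::
  "nat \<Rightarrow> gossip_algorithm \<Rightarrow> (nat \<Rightarrow> view) \<Rightarrow> (nat \<Rightarrow> nat) \<Rightarrow> (nat \<Rightarrow> nat) \<Rightarrow> nat set \<Rightarrow>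
   (nat \<Rightarrow> message) \<Rightarrow> nat \<Rightarrow> message multiset" where
  "pushed n A w c p B f u =
     (\<Sum>v | v < n \<and> p v = u.
        case act A (w v) (c v) of
          Push m \<Rightarrow> {# if u \<in> B then f v else m #}
        | Pull \<Rightarrow> {#})"

definition next_views ::
  "nat \<Rightarrow> gossip_algorithm \<Rightarrow> (nat \<Rightarrow> view) \<Rightarrow> (nat \<Rightarrow> nat) \<Rightarrow> (nat \<Rightarrow> nat) \<Rightarrow> nat set \<Rightarrow>
   (nat \<Rightarrow> message) \<Rightarrow> nat \<Rightarrow> view" where
  "next_views n A w c p B f v =
     (fst (w v), (c v, reply A w c p B f v, pushed n A w c p B f v) # snd (w v))"

definition partners :: "nat \<Rightarrow> (nat \<Rightarrow> nat) pmf" where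
  "partners n = Pi_pmf {..<n} 0 (\<lambda>_. pmf_of_set {..<n})"

definition gossip_round ::
  "nat \<Rightarrow> gossip_algorithm \<Rightarrow> adversary \<Rightarrow> (nat \<Rightarrow> nat) list \<times> (nat \<Rightarrow> view) \<Rightarrow>
   ((nat \<Rightarrow> nat) list \<times> (nat \<Rightarrow> view)) pmf" where
  "gossip_round n A D s =
     (case s of (past, w) \<Rightarrow>
        bind_pmf (Pi_pmf {..<n} 0 (\<lambda>v. coin_dist A (w v))) (\<lambda>c.
        bind_pmf (partners n) (\<lambda>p.
          let h = (past, w, c) in
          return_pmf (p # past, next_views n A w c p (attacked D h) (forged D h p)))))"

primrec run ::
  "nat \<Rightarrow> gossip_algorithm \<Rightarrow> adversary \<Rightarrow> (nat \<Rightarrow> real) \<Rightarrow> nat \<Rightarrow>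
   ((nat \<Rightarrow> nat) list \<times> (nat \<Rightarrow> view)) pmf" where
  "run n A D x 0 = return_pmf ([], \<lambda>v. (x v, []))"
| "run n A D x (Suc t) = bind_pmf (run n A D x t) (gossip_round n A D)"

definition outputs ::
  "nat \<Rightarrow> gossip_algorithm \<Rightarrow> adversary \<Rightarrow> (nat \<Rightarrow> real) \<Rightarrow> (nat \<Rightarrow> real) pmf" where
  "outputs n A D x = map_pmf (\<lambda>(past, w) v. result A (w v)) (run n A D x (rounds A))"

definition mean :: "nat \<Rightarrow> (nat \<Rightarrow> real) \<Rightarrow> real" where
  "mean n x = (\<Sum>v<n. x v) / real n"

definition mean_correctness_level ::
  "nat \<Rightarrow> real \<Rightarrow> real \<Rightarrow> real \<Rightarrow> (nat \<Rightarrow> real) \<Rightarrow> (nat \<Rightarrow> real) \<Rightarrow> bool" where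
  "mean_correctness_level n \<epsilon> M \<gamma> x y \<longleftrightarrow>
     real (card {v. v < n \<and> \<not> \<bar>y v - mean n x\<bar> \<le> \<epsilon> * M}) \<le> \<gamma> * real n"

definition solves_mean ::
  "nat \<Rightarrow> gossip_algorithm \<Rightarrow> real \<Rightarrow> real \<Rightarrow> real \<Rightarrow> real \<Rightarrow> real \<Rightarrow> bool" where
  "solves_mean n A \<beta> \<epsilon> M \<gamma> q \<longleftrightarrow>
     (\<forall>x D. (\<forall>v<n. x v \<in> {0..M}) \<longrightarrow> strong_adversary n \<beta> D \<longrightarrow>
        measure_pmf.prob (outputs n A D x) {y. mean_correctness_level n \<epsilon> M \<gamma> x y} \<ge> q)"

end

theory Submission
  imports Defs "HOL-Real_Asymp.Real_Asymp"
begin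

text \<open>
  Rescale the values to \<open>[0, 1]\<close>. If \<open>\<epsilon> \<ge> 1/2\<close>, the constant \<open>M/2\<close> is correct without communication.
  Otherwise every node first averages its value with a pulled one for \<open>T\<close> rounds. In each round the
  mean moves by at most \<open>\<eta> = \<beta> + 1/n + n powr (- 9/20)\<close> (adversary, quantisation, Hoeffding
  deviation), while the mean squared deviation from the initial mean is halved up to \<open>\<eta>\<close> and the squared drift.
  By Chebyshev at most a fraction \<open>Q\<close> of the samples, a power of \<open>max \<beta> \<gamma>\<close> (cut off at a power of
  \<open>1/n\<close>), is misleading afterwards. Then every node takes \<open>k\<close> samples of the frozen values and outputs a
  majority value; a Chernoff-type supermartingale, a product over the nodes, bounds the number of
  nodes with \<open>k/2\<close> misleading samples.
\<close>

text \<open>The split at 1/2 is forced by the round bound: if \<epsilon> and \<gamma> tend to 1 it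
  can tend to 0, so no round is affordable, whereas below 1/2 the term ln (1/\<epsilon>) exceeds ln
  2 and pays for all additive constants. The exponent 5/2 gives \<beta>/\<epsilon>^2 \<le> \<beta>
  powr (1/5) / 10000, so a power of \<beta> survives the division by \<epsilon>^2 in Chebyshev's
  inequality. Hence about ln (1/\<gamma>) / ln (1/\<beta>) samples suffice when \<beta> dominates.
  When \<gamma> dominates, averaging down to \<beta> would cost ln (1/\<beta>) rounds; stopping at
  level \<gamma> keeps the cost at ln (1/(\<gamma> + \<beta>)), and boundedly many samples are then
  enough. The exponent 9/20 balances two demands: n * n powr (- 9/10) = n powr (1/10) makes the
  Hoeffding failure superpolynomially small, while n powr (- 9/20) / \<epsilon>^2 \<le> n powr (-
  1/20) still vanishes for \<epsilon> \<ge> n powr (- 1/5). The adversary adapts to earlier samples,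
  so misses are not independent over the rounds. Only bounds conditional on the past are available,
  which is what a supermartingale needs.\<close>

section \<open>Concentration for random partners, and one averaging round\<close>

lemma set_pmf_partners:
  assumes "0 < n" "p \<in> set_pmf (partners n)" "v < n"
  shows "p v < n"
proof -
  have "{..<n} \<noteq> {}" using assms(1) by auto
  with assms(2,3) show ?thesis
    by (auto simp: partners_def set_Pi_pmf PiE_dflt_def)
qed

lemma finite_set_pmf_partners: "0 < n \<Longrightarrow> finite (set_pmf (partners n))"
proof -
  assume "0 < n"
  then have "{..<n} \<noteq> {}" by auto
  then show ?thesis
    unfolding partners_def by (subst set_Pi_pmf) (auto intro!: finite_PiE_dflt)
qed

lemma partners_expectation_prod:
  fixes f :: "nat \<Rightarrow> nat \<Rightarrow> real"
  assumes "0 < n" and nonneg: "\<And>v j. v < n \<Longrightarrow> j < n \<Longrightarrow> 0 \<le> f v j"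
  shows "measure_pmf.expectation (partners n) (\<lambda>p. \<Prod>v<n. f v (p v)) =
    (\<Prod>v<n. (\<Sum>j<n. f v j) / real n)"
proof -
  have ne: "{..<n} \<noteq> {}" using assms(1) by auto
  show ?thesis
    unfolding partners_def
    by (subst expectation_prod_Pi_pmf)
       (use ne nonneg in \<open>simp_all add: integral_pmf_of_set set_pmf_of_set integrable_measure_pmf_finite\<close>)
qed

text \<open>\<open>g\<close> may depend on the node besides its partner, because the squared
  deviation after averaging involves the node's own value.\<close>

lemma partners_hoeffding:
  fixes g :: "nat \<Rightarrow> nat \<Rightarrow> real"
  assumes n: "0 < n" and g: "\<And>v j. v < n \<Longrightarrow> j < n \<Longrightarrow> g v j \<in> {0..1}" and "0 \<le> \<delta>"
  shows "measure_pmf.prob (partners n)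
      {p. (\<Sum>v<n. g v (p v)) \<ge> (\<Sum>v<n. (\<Sum>j<n. g v j) / real n) + real n * \<delta>}
    \<le> exp (- 2 * real n * \<delta>\<^sup>2)"
proof -
  have ne: "{..<n} \<noteq> {}" using n by auto
  have indep: "prob_space.indep_vars (measure_pmf (partners n)) (\<lambda>_. borel) (\<lambda>v p. g v (p v)) {..<n}"
    unfolding partners_def
    by (rule prob_space.indep_vars_compose2[OF measure_pmf.prob_space_axioms indep_vars_Pi_pmf]) auto
  have E: "measure_pmf.expectation (partners n) (\<lambda>p. g v (p v)) = (\<Sum>j<n. g v j) / real n"
    if "v < n" for v
  proof -
    have "measure_pmf.expectation (partners n) (\<lambda>p. g v (p v)) =
      measure_pmf.expectation (map_pmf (\<lambda>p. p v) (partners n)) (g v)"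
      by simp
    also have "map_pmf (\<lambda>p. p v) (partners n) = pmf_of_set {..<n}"
      unfolding partners_def by (subst Pi_pmf_component) (use that in auto)
    also have "measure_pmf.expectation (pmf_of_set {..<n}) (g v) = (\<Sum>j<n. g v j) / real n"
      using ne by (subst integral_pmf_of_set) auto
    finally show ?thesis .
  qed
  interpret Hoeffding_ineq "measure_pmf (partners n)" "{..<n}" "\<lambda>v p. g v (p v)" "\<lambda>_. 0" "\<lambda>_. 1"
    "\<Sum>v<n. (\<Sum>j<n. g v j) / real n"
  proof unfold_locales
    show "prob_space.indep_vars (measure_pmf (partners n)) (\<lambda>_. borel) (\<lambda>v p. g v (p v)) {..<n}"
      by (rule indep)
    show "AE p in measure_pmf (partners n). g v (p v) \<in> {0..1}" if "v \<in> {..<n}" for v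
      using that set_pmf_partners[OF n] g by (intro AE_pmfI) auto
    show "(\<Sum>v<n. (\<Sum>j<n. g v j) / real n) \<equiv>
        \<Sum>v<n. measure_pmf.expectation (partners n) (\<lambda>p. g v (p v))"
      using E by (intro eq_reflection sum.cong) auto
  qed auto
  have "measure_pmf.prob (partners n) {p \<in> space (measure_pmf (partners n)).
      (\<Sum>v<n. g v (p v)) \<ge> (\<Sum>v<n. (\<Sum>j<n. g v j) / real n) + real n * \<delta>}
    \<le> exp (- 2 * (real n * \<delta>)\<^sup>2 / (\<Sum>v<n. (1 - 0)\<^sup>2))"
    by (rule Hoeffding_ineq_ge) (use n \<open>0 \<le> \<delta>\<close> in auto)
  also have "- 2 * (real n * \<delta>)\<^sup>2 / (\<Sum>v<n. (1 - 0)\<^sup>2) = - 2 * real n * \<delta>\<^sup>2"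
    using n by (simp add: power2_eq_square field_simps)
  finally show ?thesis by simp
qed

text \<open>
  \<open>y\<close> are the current values, \<open>yq\<close> their quantised versions, \<open>z p v\<close> the value received by \<open>v\<close>. Since
  \<open>z\<close> may depend on all partners, Hoeffding's inequality is applied to the functions \<open>u\<close>, \<open>l\<close>, \<open>s\<close>
  of \<open>p v\<close> alone, which take the worst value at attacked nodes.
\<close>
lemma averaging_round:
  fixes y yq :: "nat \<Rightarrow> real" and z :: "(nat \<Rightarrow> nat) \<Rightarrow> nat \<Rightarrow> real"
  assumes n: "0 < n" and m: "m \<in> {0..1}" and y: "\<And>v. v < n \<Longrightarrow> y v \<in> {0..1}"
    and yq: "\<And>v. v < n \<Longrightarrow> yq v \<in> {0..1}"
    and yq_le: "\<And>v. v < n \<Longrightarrow> yq v \<le> y v"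
    and yq_ge: "\<And>v. v < n \<Longrightarrow> y v - 1 / real n \<le> yq v"
    and B: "B \<subseteq> {..<n}" "real (card B) \<le> \<beta> * real n"
    and z: "\<And>p v. v < n \<Longrightarrow> z p v \<in> {0..1}"
    and z_honest: "\<And>p v. v < n \<Longrightarrow> p v \<notin> B \<Longrightarrow> z p v = yq (p v)"
    and \<delta>: "0 \<le> \<delta>"
  defines "y' \<equiv> \<lambda>p v. (y v + z p v) / 2"
  shows "measure_pmf.prob (partners n) {p.
      \<not> (\<bar>mean n (y' p) - m\<bar> \<le> \<bar>mean n y - m\<bar> + (\<beta> + 1 / real n + \<delta>) \<and>
         mean n (\<lambda>v. (y' p v - m)\<^sup>2) \<le>
           mean n (\<lambda>v. (y v - m)\<^sup>2) / 2 + (mean n y - m)\<^sup>2 / 2 + (\<beta> + 1 / real n + \<delta>))}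
    \<le> 3 * exp (- 2 * real n * \<delta>\<^sup>2)"
proof -
  define u where "u = (\<lambda>(v::nat) j. if j \<in> B then 1 else yq j)"
  \<comment> \<open>Only upper tails are available, so the lower bound on the received sum is
    obtained from the upper tail of the complements.\<close>
  define l where "l = (\<lambda>(v::nat) j. if j \<in> B then 1 else 1 - yq j)"
  define s where "s = (\<lambda>v j. if j \<in> B then 1 else ((y v + yq j) / 2 - m)\<^sup>2)"
  define Ev where "Ev = (\<lambda>g. {p. (\<Sum>v<n. g v (p v)) \<ge>
    (\<Sum>v<n. (\<Sum>j<n. g v j) / real n) + real n * \<delta>})"
  have sq: "(a - m)\<^sup>2 \<in> {0..1}" if "a \<in> {0..1}" for a
  proof -
    have "\<bar>a - m\<bar> \<le> 1" using that m by auto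
    then show ?thesis by (simp add: abs_square_le_1)
  qed
  have sq_avg: "((y v + c) / 2 - m)\<^sup>2 \<in> {0..1}" if "v < n" "c \<in> {0..1}" for v c
    using y[OF that(1)] that(2) by (intro sq) auto
  have fB: "(\<Sum>j<n. if j \<in> B then 1 else f j) \<le> real (card B) + (\<Sum>j<n. f j)"
    if "\<And>j. j < n \<Longrightarrow> 0 \<le> f j" for f :: "nat \<Rightarrow> real"
  proof -
    have "(\<Sum>j<n. if j \<in> B then 1 else f j) \<le> (\<Sum>j<n. (if j \<in> B then 1 else 0) + f j)"
      by (intro sum_mono) (use that in auto)
    also have "\<dots> = (\<Sum>j<n. if j \<in> B then 1 else (0::real)) + (\<Sum>j<n. f j)"
      by (rule sum.distrib)
    also have "(\<Sum>j<n. if j \<in> B then 1 else (0::real)) = real (card B)"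
      using B(1) by (simp add: sum.If_cases Int_absorb1)
    finally show ?thesis .
  qed
  let ?S = "\<Sum>v<n. y v" and ?V = "\<Sum>v<n. (y v - m)\<^sup>2"
  have sum_u: "(\<Sum>v<n. (\<Sum>j<n. u v j) / real n) \<le> \<beta> * real n + ?S"
  proof -
    have "(\<Sum>v<n. (\<Sum>j<n. u v j) / real n) = (\<Sum>j<n. if j \<in> B then 1 else yq j)"
      using n by (simp add: u_def)
    also have "\<dots> \<le> real (card B) + (\<Sum>j<n. yq j)"
      by (rule fB) (use yq in auto)
    also have "(\<Sum>j<n. yq j) \<le> ?S" by (intro sum_mono) (use yq_le in auto)
    finally show ?thesis using B(2) by linarith
  qed
  have sum_l: "(\<Sum>v<n. (\<Sum>j<n. l v j) / real n) \<le> \<beta> * real n + real n - ?S + 1"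
  proof -
    have "(\<Sum>v<n. (\<Sum>j<n. l v j) / real n) = (\<Sum>j<n. if j \<in> B then 1 else 1 - yq j)"
      using n by (simp add: l_def)
    also have "\<dots> \<le> real (card B) + (\<Sum>j<n. 1 - yq j)"
      by (rule fB) (use yq in auto)
    also have "(\<Sum>j<n. 1 - yq j) \<le> (\<Sum>j<n. 1 - y j + 1 / real n)"
      by (intro sum_mono) (use yq_ge in \<open>auto simp: algebra_simps\<close>)
    also have "\<dots> = real n - ?S + 1" using n by (simp add: sum.distrib sum_subtractf)
    finally show ?thesis using B(2) by linarith
  qed
  \<comment> \<open>In the sum over all pairs the squares contribute \<open>?V / 2\<close> per node.
    Deviations are measured from the fixed \<open>m\<close>, not from the current mean, so the cross
    terms do not cancel; they factor into the squared drift. The final 1 is the total rounding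
    loss.\<close>
  have sum_s: "(\<Sum>v<n. (\<Sum>j<n. s v j) / real n) \<le>
      \<beta> * real n + ?V / 2 + real n * (mean n y - m)\<^sup>2 / 2 + 1"
  proof -
    have row: "(\<Sum>j<n. s v j) \<le> \<beta> * real n + (real n * (y v - m)\<^sup>2 + ?V) / 4
        + (y v - m) * (?S - real n * m) / 2 + 1" if v: "v < n" for v
    proof -
      have "(\<Sum>j<n. s v j) \<le> real (card B) + (\<Sum>j<n. ((y v + yq j) / 2 - m)\<^sup>2)"
        unfolding s_def by (rule fB) auto
      also have "(\<Sum>j<n. ((y v + yq j) / 2 - m)\<^sup>2) \<le> (\<Sum>j<n. ((y v + y j) / 2 - m)\<^sup>2 + 1 / real n)"
      proof (intro sum_mono)
        fix j assume "j \<in> {..<n}"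
        then have j: "j < n" by simp
        define a where "a = (y v + yq j) / 2 - m"
        define b where "b = (y v + y j) / 2 - m"
        have ab: "a \<le> b" "b - a \<le> 1 / (2 * real n)"
          unfolding a_def b_def using yq_le[OF j] yq_ge[OF j] by (simp_all add: field_simps)
        have "- (a + b) \<le> 2" using y[OF v] y[OF j] yq[OF j] m unfolding a_def b_def
          by (simp add: field_simps)
        then have "(b - a) * (- (a + b)) \<le> (b - a) * 2"
          using ab by (intro mult_left_mono) auto
        then have "a\<^sup>2 - b\<^sup>2 \<le> 2 * (b - a)" by (simp add: power2_eq_square algebra_simps)
        also have "\<dots> \<le> 1 / real n" using ab(2) n by (simp add: field_simps)
        finally show "((y v + yq j) / 2 - m)\<^sup>2 \<le> ((y v + y j) / 2 - m)\<^sup>2 + 1 / real n"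
          by (simp add: a_def b_def)
      qed
      also have "\<dots> = (\<Sum>j<n. ((y v + y j) / 2 - m)\<^sup>2) + 1"
        using n by (simp add: sum.distrib)
      also have "(\<Sum>j<n. ((y v + y j) / 2 - m)\<^sup>2) =
          (\<Sum>j<n. ((y v - m)\<^sup>2 + (y j - m)\<^sup>2) / 4 + (y v - m) * (y j - m) / 2)"
        by (intro sum.cong refl) (simp add: power2_eq_square field_simps)
      also have "(\<Sum>j<n. ((y v - m)\<^sup>2 + (y j - m)\<^sup>2) / 4 + (y v - m) * (y j - m) / 2) =
          (real n * (y v - m)\<^sup>2 + ?V) / 4 + (y v - m) * (?S - real n * m) / 2"
        by (simp add: sum.distrib sum_subtractf flip: sum_divide_distrib sum_distrib_left)
      finally show ?thesis using B(2) by linarith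
    qed
    have "(\<Sum>v<n. \<Sum>j<n. s v j) \<le> (\<Sum>v<n. \<beta> * real n + (real n * (y v - m)\<^sup>2 + ?V) / 4
        + (y v - m) * (?S - real n * m) / 2 + 1)"
      by (intro sum_mono) (use row in auto)
    also have "\<dots> = real n * (\<beta> * real n) + (real n * ?V + real n * ?V) / 4 +
        (?S - real n * m) * (?S - real n * m) / 2 + real n"
      by (simp add: sum.distrib sum_subtractf flip: sum_divide_distrib sum_distrib_left sum_distrib_right)
    also have "?S - real n * m = real n * (mean n y - m)"
      using n by (simp add: mean_def field_simps)
    finally have "(\<Sum>v<n. \<Sum>j<n. s v j) \<le>
      real n * (\<beta> * real n + ?V / 2 + real n * (mean n y - m)\<^sup>2 / 2 + 1)"
      by (simp add: power2_eq_square algebra_simps)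
    then show ?thesis
      using n by (simp add: field_simps flip: sum_divide_distrib)
  qed
  have good: "\<bar>mean n (y' p) - m\<bar> \<le> \<bar>mean n y - m\<bar> + (\<beta> + 1 / real n + \<delta>) \<and>
      mean n (\<lambda>v. (y' p v - m)\<^sup>2) \<le>
        mean n (\<lambda>v. (y v - m)\<^sup>2) / 2 + (mean n y - m)\<^sup>2 / 2 + (\<beta> + 1 / real n + \<delta>)"
    if not: "p \<notin> Ev u" "p \<notin> Ev l" "p \<notin> Ev s" for p
  proof -
    have "(\<Sum>v<n. z p v) \<le> (\<Sum>v<n. u v (p v))"
      using z z_honest by (intro sum_mono) (fastforce simp: u_def)
    also have "\<dots> \<le> \<beta> * real n + ?S + real n * \<delta>"
      using not(1) sum_u by (simp add: Ev_def)
    finally have up: "(\<Sum>v<n. z p v) \<le> \<beta> * real n + ?S + real n * \<delta>" .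
    have "(\<Sum>v<n. 1 - z p v) \<le> (\<Sum>v<n. l v (p v))"
      using z z_honest by (intro sum_mono) (fastforce simp: l_def)
    also have "\<dots> \<le> \<beta> * real n + real n - ?S + 1 + real n * \<delta>"
      using not(2) sum_l by (simp add: Ev_def)
    finally have low: "(\<Sum>v<n. z p v) \<ge> ?S - \<beta> * real n - 1 - real n * \<delta>"
      by (simp add: sum_subtractf)
    have mean': "mean n (y' p) = (mean n y + mean n (z p)) / 2"
      by (simp add: mean_def y'_def sum.distrib add_divide_distrib flip: sum_divide_distrib)
    have "mean n (z p) \<le> (\<beta> * real n + ?S + real n * \<delta>) / real n"
      unfolding mean_def using up by (intro divide_right_mono) auto
    then have 1: "mean n (z p) \<le> mean n y + \<beta> + \<delta>"
      using n by (simp add: mean_def field_simps)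
    have "mean n (z p) \<ge> (?S - \<beta> * real n - 1 - real n * \<delta>) / real n"
      unfolding mean_def using low by (intro divide_right_mono) auto
    then have 2: "mean n (z p) \<ge> mean n y - \<beta> - 1 / real n - \<delta>"
      using n by (simp add: mean_def diff_divide_distrib)
    have n_inv: "0 \<le> 1 / real n" by simp
    have "0 \<le> \<beta>" using B(2) n by (metis of_nat_0_le_iff of_nat_0_less_iff order_trans zero_le_mult_iff not_le)
    then have ineq: "\<bar>mean n (y' p) - mean n y\<bar> \<le> \<beta> + 1 / real n + \<delta>"
      unfolding mean' using 1 2 \<delta> n_inv by argo
    have "(\<Sum>v<n. (y' p v - m)\<^sup>2) \<le> (\<Sum>v<n. s v (p v))"
      using z z_honest sq_avg by (intro sum_mono) (fastforce simp: s_def y'_def)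
    also have "\<dots> \<le> \<beta> * real n + ?V / 2 + real n * (mean n y - m)\<^sup>2 / 2 + 1 + real n * \<delta>"
      using not(3) sum_s by (simp add: Ev_def)
    finally have "mean n (\<lambda>v. (y' p v - m)\<^sup>2) \<le>
      (\<beta> * real n + ?V / 2 + real n * (mean n y - m)\<^sup>2 / 2 + 1 + real n * \<delta>) / real n"
      unfolding mean_def[of n "\<lambda>v. (y' p v - m)\<^sup>2"] by (intro divide_right_mono) auto
    also have "\<dots> = mean n (\<lambda>v. (y v - m)\<^sup>2) / 2 + (mean n y - m)\<^sup>2 / 2 + (\<beta> + 1 / real n + \<delta>)"
      unfolding mean_def[of n "\<lambda>v. (y v - m)\<^sup>2"] using n by (simp add: field_simps)
    finally show ?thesis using ineq by linarith
  qed
  have "measure_pmf.prob (partners n) {p.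
      \<not> (\<bar>mean n (y' p) - m\<bar> \<le> \<bar>mean n y - m\<bar> + (\<beta> + 1 / real n + \<delta>) \<and>
         mean n (\<lambda>v. (y' p v - m)\<^sup>2) \<le>
           mean n (\<lambda>v. (y v - m)\<^sup>2) / 2 + (mean n y - m)\<^sup>2 / 2 + (\<beta> + 1 / real n + \<delta>))}
    \<le> measure_pmf.prob (partners n) (Ev u \<union> Ev l \<union> Ev s)"
    by (rule measure_pmf.finite_measure_mono) (use good in blast, simp)
  also have "\<dots> \<le> measure_pmf.prob (partners n) (Ev u) + measure_pmf.prob (partners n) (Ev l)
      + measure_pmf.prob (partners n) (Ev s)"
    by (intro order_trans[OF measure_Un_le] add_mono) auto
  also have "\<dots> \<le> exp (- 2 * real n * \<delta>\<^sup>2) + exp (- 2 * real n * \<delta>\<^sup>2) + exp (- 2 * real n * \<delta>\<^sup>2)"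
    unfolding Ev_def using yq sq_avg
    by (intro add_mono partners_hoeffding n \<delta>) (auto simp: u_def l_def s_def)
  finally show ?thesis by simp
qed

section \<open>Accumulation of failure probabilities over the rounds\<close>

text \<open>A union bound over rounds: a state that violates the invariant is charged probability 1,
  so a bound on one round is required only from good states, whatever the adversary learned on the
  way.\<close>

lemma run_invariant:
  assumes "\<And>s. s \<in> set_pmf (run n A D x 0) \<Longrightarrow> I 0 s"
    and "\<And>t s. I t s \<Longrightarrow> measure_pmf.prob (gossip_round n A D s) {s'. \<not> I (Suc t) s'} \<le> \<delta> t"
    and "\<And>t. 0 \<le> \<delta> t"
  shows "measure_pmf.prob (run n A D x t) {s. \<not> I t s} \<le> (\<Sum>i<t. \<delta> i)"
proof (induction t)
  case 0
  then show ?case using assms(1) by (auto simp: measure_pmf_zero_iff)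
next
  case (Suc t)
  have "emeasure (run n A D x (Suc t)) {s. \<not> I (Suc t) s} =
      (\<integral>\<^sup>+s. emeasure (gossip_round n A D s) {s. \<not> I (Suc t) s} \<partial>run n A D x t)"
    by simp
  also have "\<dots> \<le> (\<integral>\<^sup>+s. ennreal (\<delta> t) + indicator {s. \<not> I t s} s \<partial>run n A D x t)"
  proof (rule nn_integral_mono)
    fix s
    show "emeasure (gossip_round n A D s) {s. \<not> I (Suc t) s} \<le> ennreal (\<delta> t) + indicator {s. \<not> I t s} s"
    proof (cases "I t s")
      case True
      then show ?thesis
        using assms(2)[OF True] by (auto simp: measure_pmf.emeasure_eq_measure intro!: ennreal_leI)
    next
      case False
      have "emeasure (gossip_round n A D s) {s. \<not> I (Suc t) s} \<le> 1"
        by (rule measure_pmf.emeasure_le_1)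
      then show ?thesis using False by (simp add: add_increasing)
    qed
  qed
  also have "\<dots> = ennreal (\<delta> t) + emeasure (run n A D x t) {s. \<not> I t s}"
    by (subst nn_integral_add) auto
  also have "\<dots> = ennreal (\<delta> t + measure_pmf.prob (run n A D x t) {s. \<not> I t s})"
    using assms(3) by (simp add: measure_pmf.emeasure_eq_measure ennreal_plus)
  finally have "measure_pmf.prob (run n A D x (Suc t)) {s. \<not> I (Suc t) s} \<le>
    \<delta> t + measure_pmf.prob (run n A D x t) {s. \<not> I t s}"
    using assms(3)[of t] by (simp add: measure_pmf.emeasure_eq_measure flip: ennreal_plus)
  then show ?case using Suc by simp
qed

section \<open>Quantised messages\<close>

definition encode :: "nat \<Rightarrow> nat \<Rightarrow> real \<Rightarrow> message" where
  "encode L n y = map (bit (nat \<lfloor>real n * y\<rfloor>)) [0..<L]"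

text \<open>The cap at 1 is for forged messages: every bit list decodes into the unit interval, so a
  single forged reply changes an averaged value by at most 1/2.\<close>

definition decode :: "nat \<Rightarrow> message \<Rightarrow> real" where
  "decode n bs = min 1 (real (horner_sum of_bool 2 bs) / real n)"

lemma decode_range: "decode n bs \<in> {0..1}"
  by (simp add: decode_def)

lemma decode_encode:
  assumes "0 < n" "n < 2 ^ L" "y \<in> {0..1}"
  shows "decode n (encode L n y) = real_of_int \<lfloor>real n * y\<rfloor> / real n"
proof -
  have "real n * y \<le> real n" using assms(3) by (simp add: mult_left_le)
  then have le: "nat \<lfloor>real n * y\<rfloor> \<le> n" by linarith
  then have "horner_sum of_bool 2 (encode L n y) = nat \<lfloor>real n * y\<rfloor>"
    using assms(2) unfolding encode_def horner_sum_bit_eq_take_bit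
    by (intro take_bit_nat_eq_self) linarith
  moreover have "real_of_int \<lfloor>real n * y\<rfloor> \<le> real n" "0 \<le> \<lfloor>real n * y\<rfloor>"
    using le assms(3) by auto
  ultimately show ?thesis using assms(1) by (simp add: decode_def min_def)
qed

lemma decode_encode_le:
  assumes "0 < n" "n < 2 ^ L" "y \<in> {0..1}"
  shows "decode n (encode L n y) \<le> y"
  using assms(1) by (simp add: decode_encode[OF assms] field_simps)

lemma decode_encode_ge:
  assumes "0 < n" "n < 2 ^ L" "y \<in> {0..1}"
  shows "y - 1 / real n \<le> decode n (encode L n y)"
proof -
  have "real n * y - 1 \<le> real_of_int \<lfloor>real n * y\<rfloor>" by linarith
  then have "(real n * y - 1) / real n \<le> real_of_int \<lfloor>real n * y\<rfloor> / real n"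
    by (rule divide_right_mono) simp
  then show ?thesis using assms(1) by (simp add: decode_encode[OF assms] diff_divide_distrib)
qed

section \<open>The algorithm and its effect on local views\<close>

locale mean_gossip =
  fixes n T k L :: nat and M e :: real
begin

definition received :: "round_log \<Rightarrow> real" where
  "received r = decode n (the (fst (snd r)))"

text \<open>Logs are listed most recent first, so \<open>length rs < T\<close> says that
  \<open>r\<close> belongs to one of the first \<open>T\<close> rounds. All later logs leave the
  value frozen.\<close>

primrec average :: "real \<Rightarrow> round_log list \<Rightarrow> real" where
  "average a [] = a"
| "average a (r # rs) = (if length rs < T then (average a rs + received r) / 2 else average a rs)"

definition estimate :: "view \<Rightarrow> real" where
  "estimate w = average (fst w / M) (snd w)"

text \<open>
  Any two such \<open>z\<close> are \<open>e\<close>-close, since two strict majorities share a sample: the choice plays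
  the role of a median.
\<close>
definition majority_value :: "round_log list \<Rightarrow> real" where
  "majority_value rs = (SOME z. k < 2 * length (filter (\<lambda>r. \<bar>received r - z\<bar> \<le> e / 2) (take k rs)))"

definition algorithm :: gossip_algorithm where
  "algorithm = \<lparr>rounds = T + k, coin_dist = \<lambda>_. return_pmf 0, act = \<lambda>_ _. Pull,
     answer = \<lambda>w _. encode L n (estimate w), result = \<lambda>w. M * majority_value (snd w)\<rparr>"

text \<open>The logs after round \<open>T\<close> form an initial segment of the list. Truncated
  subtraction makes this segment empty during averaging, so counting starts from 0.\<close>

definition misses :: "real \<Rightarrow> view \<Rightarrow> nat" where
  "misses m w = length (filter (\<lambda>r. e / 2 < \<bar>received r - m\<bar>) (take (length (snd w) - T) (snd w)))"

lemma message_size: "message_size_le algorithm L"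
  by (simp add: message_size_le_def algorithm_def encode_def)

lemma next_views_algorithm:
  obtains r where "next_views n algorithm w c p B f v = (fst (w v), r # snd (w v))"
    and "received r = decode n (if p v \<in> B then f v else encode L n (estimate (w (p v))))"
  by (simp add: next_views_def reply_def algorithm_def received_def)

lemma estimate_next_views:
  "estimate (next_views n algorithm w c p B f v) =
    (if length (snd (w v)) < T
     then (estimate (w v) + decode n (if p v \<in> B then f v else encode L n (estimate (w (p v))))) / 2
     else estimate (w v))"
  by (rule next_views_algorithm[of w c p B f v]) (simp add: estimate_def)

lemma length_next_views: "length (snd (next_views n A w c p B f v)) = Suc (length (snd (w v)))"
  by (simp add: next_views_def)

lemma misses_next_views:
  assumes "T \<le> length (snd (w v))"
  shows "misses m (next_views n algorithm w c p B f v) = misses m (w v) +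
    (if e / 2 < \<bar>decode n (if p v \<in> B then f v else encode L n (estimate (w (p v)))) - m\<bar> then 1 else 0)"
  by (rule next_views_algorithm[of w c p B f v]) (use assms in \<open>simp add: misses_def Suc_diff_le\<close>)

text \<open>Without private coins the coin vector is the constant 0, so the attacked set is
  determined by the past and the partners are the only randomness of a round.\<close>

lemma gossip_round_algorithm:
  "gossip_round n algorithm D (past, w) = map_pmf (\<lambda>p. (p # past,
      next_views n algorithm w (\<lambda>_. 0) p (attacked D (past, w, \<lambda>_. 0)) (forged D (past, w, \<lambda>_. 0) p)))
    (partners n)"
  by (simp add: gossip_round_def algorithm_def map_pmf_def bind_return_pmf Let_def)

lemma majority_value_close:
  assumes "length rs = k" "2 * length (filter (\<lambda>r. e / 2 < \<bar>received r - m\<bar>) rs) < k"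
  shows "\<bar>majority_value rs - m\<bar> \<le> e"
proof -
  define hits where "hits = (\<lambda>z. length (filter (\<lambda>r. \<bar>received r - z\<bar> \<le> e / 2) rs))"
  have "length (filter (\<lambda>r. e / 2 < \<bar>received r - m\<bar>) rs) + hits m = k"
    using sum_length_filter_compl[of "\<lambda>r. e / 2 < \<bar>received r - m\<bar>" rs] assms(1)
    by (simp add: hits_def not_less)
  then have "k < 2 * hits m" using assms(2) by linarith
  then have "k < 2 * hits (majority_value rs)"
    using assms(1) someI[of "\<lambda>z. k < 2 * hits z" m]
    by (simp add: majority_value_def hits_def)
  then have *: "length (filter (\<lambda>r. e / 2 < \<bar>received r - m\<bar>) rs) < hits (majority_value rs)"
    using assms(2) by linarith
  have "\<exists>r\<in>set rs. \<bar>received r - majority_value rs\<bar> \<le> e / 2 \<and> \<bar>received r - m\<bar> \<le> e / 2"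
  proof (rule ccontr)
    assume "\<not> ?thesis"
    then have "filter (\<lambda>r. \<bar>received r - majority_value rs\<bar> \<le> e / 2) rs =
        filter (\<lambda>r. \<bar>received r - majority_value rs\<bar> \<le> e / 2) (filter (\<lambda>r. e / 2 < \<bar>received r - m\<bar>) rs)"
      by (simp only: filter_filter) (rule filter_cong, auto simp: not_le)
    then have "hits (majority_value rs) \<le> length (filter (\<lambda>r. e / 2 < \<bar>received r - m\<bar>) rs)"
      unfolding hits_def by (metis length_filter_le)
    with * show False by linarith
  qed
  then show ?thesis by (auto simp: abs_if split: if_splits)
qed

end

section \<open>The averaging phase against the adversary\<close>

locale mean_gossip_run = mean_gossip +
  fixes D :: adversary and x :: "nat \<Rightarrow> real" and \<beta> \<delta> Q :: real
  assumes n: "0 < n" "n < 2 ^ L"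
    and e: "4 / real n \<le> e"
    and \<delta>: "0 \<le> \<delta>"
    and x: "\<And>v. v < n \<Longrightarrow> x v \<in> {0..M}"
    and D: "strong_adversary n \<beta> D"
    and Q: "0 < Q" "Q \<le> 1"
      "16 * ((1 / 2) ^ T + 2 * (\<beta> + 1 / real n + \<delta>) + (real T * (\<beta> + 1 / real n + \<delta>))\<^sup>2) / e\<^sup>2 + \<beta> \<le> Q"
begin

abbreviation \<eta> :: real where "\<eta> \<equiv> \<beta> + 1 / real n + \<delta>"

definition m :: real where "m = mean n (\<lambda>v. x v / M)"

lemma M_nonneg: "0 \<le> M"
  using x[OF n(1)] by auto

lemma x_scaled: "v < n \<Longrightarrow> x v / M \<in> {0..1}"
  using x[of v] M_nonneg by (auto simp: divide_le_eq)

lemma m_range: "m \<in> {0..1}"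
proof -
  have "(\<Sum>v<n. x v / M) \<le> (\<Sum>v<n. 1)" by (intro sum_mono) (use x_scaled in auto)
  moreover have "0 \<le> (\<Sum>v<n. x v / M)" by (intro sum_nonneg) (use x_scaled in auto)
  ultimately show ?thesis using n by (simp add: m_def mean_def divide_le_eq)
qed

text \<open>This survives \<open>M = 0\<close>: division by 0 yields 0, and then all initial values
  vanish as well.\<close>

lemma scaled_mean: "M * m = mean n x"
proof (cases "M = 0")
  case True
  then have "\<And>v. v < n \<Longrightarrow> x v = 0" using x by force
  then show ?thesis using True by (simp add: mean_def)
next
  case False
  then show ?thesis by (simp add: m_def mean_def sum_distrib_left)
qed

lemma \<beta>_nonneg: "0 \<le> \<beta>"
proof -
  have "0 \<le> \<beta> * real n" using D unfolding strong_adversary_def by (meson of_nat_0_le_iff order_trans)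
  then show ?thesis using n by (simp add: zero_le_mult_iff)
qed

lemma \<eta>_nonneg: "0 \<le> \<eta>"
  using \<beta>_nonneg \<delta> by simp

lemma e_pos: "0 < e"
  using e n by (meson divide_pos_pos less_le_trans of_nat_0_less_iff zero_less_numeral)

text \<open>With the drift bounded by T\<eta> throughout, one round maps a bound W on the mean
  squared deviation to W/2 + (T\<eta>)^2/2 + \<eta>. The fixed point of this map is 2\<eta> +
  (T\<eta>)^2, and the power of 1/2 is the shrinking distance from it. The minimum with
  \<open>T\<close> makes one invariant serve both phases.\<close>

definition drift_bounded :: "nat \<Rightarrow> (nat \<Rightarrow> nat) list \<times> (nat \<Rightarrow> view) \<Rightarrow> bool" where
  "drift_bounded t s \<longleftrightarrow> (\<forall>v. length (snd (snd s v)) = t) \<and> (\<forall>v<n. estimate (snd s v) \<in> {0..1}) \<and>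
    \<bar>mean n (\<lambda>v. estimate (snd s v)) - m\<bar> \<le> real (min t T) * \<eta> \<and>
    mean n (\<lambda>v. (estimate (snd s v) - m)\<^sup>2) \<le> (1 / 2) ^ min t T + 2 * \<eta> + (real T * \<eta>)\<^sup>2"

lemma drift_bounded_0: "drift_bounded 0 ([], \<lambda>v. (x v, []))"
proof -
  have "mean n (\<lambda>v. (x v / M - m)\<^sup>2) \<le> 1"
  proof -
    have "(x v / M - m)\<^sup>2 \<le> 1" if "v < n" for v
      using x_scaled[OF that] m_range by (subst abs_square_le_1) (auto simp: abs_le_iff)
    then have "(\<Sum>v<n. (x v / M - m)\<^sup>2) \<le> (\<Sum>v<n. 1)" by (intro sum_mono) auto
    then show ?thesis using n by (simp add: mean_def divide_le_eq)
  qed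
  moreover have "0 \<le> 2 * \<eta> + (real T * \<eta>)\<^sup>2" using \<eta>_nonneg by simp
  ultimately have "mean n (\<lambda>v. (x v / M - m)\<^sup>2) \<le> 1 + 2 * \<eta> + (real T * \<eta>)\<^sup>2" by linarith
  then show ?thesis using x_scaled m_def by (auto simp: drift_bounded_def estimate_def)
qed

text \<open>After round \<open>T\<close> no estimate changes, whatever is forged. The equivalence
  also says that a violated invariant stays violated, which lets \<open>potential\<close> vanish
  permanently on bad states.\<close>

lemma drift_bounded_frozen:
  assumes "T \<le> t"
  shows "drift_bounded (Suc t) (q, next_views n algorithm w c p B f) \<longleftrightarrow> drift_bounded t (past, w)"
proof -
  have eq: "estimate (next_views n algorithm w c p B f v) = estimate (w v)"
    if "\<forall>v. length (snd (w v)) = t" for v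
    using that assms by (simp add: estimate_next_views)
  show ?thesis
  proof (cases "\<forall>v. length (snd (w v)) = t")
    case True
    then show ?thesis using assms by (simp add: drift_bounded_def length_next_views eq[OF True])
  next
    case False
    then show ?thesis by (auto simp: drift_bounded_def length_next_views)
  qed
qed

lemma drift_bounded_Suc:
  assumes I: "drift_bounded t s"
  shows "measure_pmf.prob (gossip_round n algorithm D s) {s'. \<not> drift_bounded (Suc t) s'}
    \<le> (if t < T then 3 * exp (- 2 * real n * \<delta>\<^sup>2) else 0)"
proof -
  obtain past w where s: "s = (past, w)" by force
  define B where "B = attacked D (past, w, \<lambda>_. 0)"
  define f where "f = forged D (past, w, \<lambda>_. 0)"
  define w' where "w' = (\<lambda>p. next_views n algorithm w (\<lambda>_. 0) p B (f p))"
  have prob: "measure_pmf.prob (gossip_round n algorithm D s) {s'. \<not> drift_bounded (Suc t) s'} =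
      measure_pmf.prob (partners n) {p. \<not> drift_bounded (Suc t) (p # past, w' p)}"
    by (simp add: s gossip_round_algorithm B_def f_def w'_def vimage_def)
  show ?thesis
  proof (cases "t < T")
    case False
    then have "drift_bounded (Suc t) (p # past, w' p)" for p
      using I False unfolding s w'_def by (subst drift_bounded_frozen[where past = past]) auto
    then show ?thesis using prob False by simp
  next
    case True
    define y where "y = (\<lambda>v. estimate (w v))"
    define yq where "yq = (\<lambda>v. decode n (encode L n (y v)))"
    define z where "z = (\<lambda>p v. decode n (if p v \<in> B then f p v else encode L n (y (p v))))"
    have len: "length (snd (w v)) = t" for v using I by (simp add: drift_bounded_def s)
    have y: "y v \<in> {0..1}" if "v < n" for v using I that by (simp add: drift_bounded_def s y_def)
    have y': "estimate (w' p v) = (y v + z p v) / 2" for p v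
      using True len by (simp add: w'_def estimate_next_views y_def z_def)
    have mean_t: "\<bar>mean n y - m\<bar> \<le> real t * \<eta>"
      using I True by (simp add: drift_bounded_def s y_def)
    have sq_t: "mean n (\<lambda>v. (y v - m)\<^sup>2) \<le> (1 / 2) ^ t + 2 * \<eta> + (real T * \<eta>)\<^sup>2"
      using I True by (simp add: drift_bounded_def s y_def)
    have "real t * \<eta> \<le> real T * \<eta>" using True \<eta>_nonneg by (intro mult_right_mono) auto
    then have "\<bar>mean n y - m\<bar> \<le> real T * \<eta>" using mean_t by linarith
    then have "\<bar>mean n y - m\<bar>\<^sup>2 \<le> (real T * \<eta>)\<^sup>2" by (rule power_mono) simp
    then have sq: "(mean n y - m)\<^sup>2 \<le> (real T * \<eta>)\<^sup>2" by simp
    have z_range: "z p v \<in> {0..1}" for p v by (simp add: z_def decode_range del: atLeastAtMost_iff)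
    have halve: "a \<le> 1 / 2 * P + 2 * h + S"
      if "a \<le> W / 2 + d / 2 + h" "W \<le> P + 2 * h + S" "d \<le> S" for a W d h P S :: real
      using that by linarith
    have imp: "drift_bounded (Suc t) (p # past, w' p)"
      if "\<bar>mean n (\<lambda>v. (y v + z p v) / 2) - m\<bar> \<le> \<bar>mean n y - m\<bar> + \<eta> \<and>
         mean n (\<lambda>v. ((y v + z p v) / 2 - m)\<^sup>2) \<le>
           mean n (\<lambda>v. (y v - m)\<^sup>2) / 2 + (mean n y - m)\<^sup>2 / 2 + \<eta>" for p
      unfolding drift_bounded_def snd_conv y'
    proof (intro conjI allI impI)
      show "length (snd (w' p v)) = Suc t" for v by (simp add: w'_def length_next_views len)
      show "(y v + z p v) / 2 \<in> {0..1}" if "v < n" for v using y[OF that] z_range[of p v] by auto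
      have min: "min (Suc t) T = Suc t" using True by simp
      show "\<bar>mean n (\<lambda>v. (y v + z p v) / 2) - m\<bar> \<le> real (min (Suc t) T) * \<eta>"
        unfolding min using that mean_t by (simp only: of_nat_Suc distrib_right mult_1_left) linarith
      show "mean n (\<lambda>v. ((y v + z p v) / 2 - m)\<^sup>2) \<le>
          (1 / 2) ^ min (Suc t) T + 2 * \<eta> + (real T * \<eta>)\<^sup>2"
        unfolding min power_Suc by (rule halve[OF _ sq_t sq]) (use that in blast)
    qed
    have "measure_pmf.prob (partners n) {p. \<not> drift_bounded (Suc t) (p # past, w' p)}
      \<le> measure_pmf.prob (partners n) {p.
        \<not> (\<bar>mean n (\<lambda>v. (y v + z p v) / 2) - m\<bar> \<le> \<bar>mean n y - m\<bar> + \<eta> \<and>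
         mean n (\<lambda>v. ((y v + z p v) / 2 - m)\<^sup>2) \<le>
           mean n (\<lambda>v. (y v - m)\<^sup>2) / 2 + (mean n y - m)\<^sup>2 / 2 + \<eta>)}"
      by (rule measure_pmf.finite_measure_mono) (use imp in blast, simp)
    also have "\<dots> \<le> 3 * exp (- 2 * real n * \<delta>\<^sup>2)"
    proof (rule averaging_round[where yq = yq and B = B, OF n(1) m_range])
      show "B \<subseteq> {..<n}" "real (card B) \<le> \<beta> * real n"
        using D by (auto simp: strong_adversary_def B_def)
      show "yq v \<in> {0..1}" for v unfolding yq_def by (rule decode_range)
      show "yq v \<le> y v" if "v < n" for v
        unfolding yq_def by (rule decode_encode_le[OF n y[OF that]])
      show "y v - 1 / real n \<le> yq v" if "v < n" for v
        unfolding yq_def by (rule decode_encode_ge[OF n y[OF that]])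
      show "z p v = yq (p v)" if "p v \<notin> B" for p v
        using that by (simp add: z_def yq_def)
    qed (use y z_range \<delta> in blast)+
    finally show ?thesis using prob True by simp
  qed
qed

lemma prob_drift_bounded:
  "measure_pmf.prob (run n algorithm D x t) {s. \<not> drift_bounded t s} \<le> 3 * real T * exp (- 2 * real n * \<delta>\<^sup>2)"
proof -
  let ?\<delta> = "\<lambda>t. if t < T then 3 * exp (- 2 * real n * \<delta>\<^sup>2) else 0"
  have "measure_pmf.prob (run n algorithm D x t) {s. \<not> drift_bounded t s} \<le> (\<Sum>i<t. ?\<delta> i)"
    by (rule run_invariant) (use drift_bounded_0 drift_bounded_Suc in auto)
  also have "\<dots> = real (card {i \<in> {..<t}. i < T}) * (3 * exp (- 2 * real n * \<delta>\<^sup>2))"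
    by (subst sum.inter_filter[symmetric]) auto
  also have "\<dots> \<le> real (card {..<T}) * (3 * exp (- 2 * real n * \<delta>\<^sup>2))"
    by (intro mult_right_mono of_nat_mono card_mono) auto
  finally show ?thesis by simp
qed

end

section \<open>The sampling phase\<close>

context mean_gossip_run
begin

text \<open>Since rounding costs at most 1/n \<le> e/4, a quantised value off by e/2 comes from an
  estimate off by e/4; Chebyshev's inequality then produces the factor 16/e^2. The share \<beta> is
  left free for the attacked nodes, so that a sample misses with probability at most
  \<open>Q\<close> in total.\<close>

lemma card_misleading:
  assumes I: "drift_bounded t s" and "T \<le> t"
  shows "real (card {u. u < n \<and> e / 2 < \<bar>decode n (encode L n (estimate (snd s u))) - m\<bar>})
    \<le> (Q - \<beta>) * real n"
proof -
  define y where "y = (\<lambda>u. estimate (snd s u))"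
  define W where "W = (1 / 2) ^ T + 2 * \<eta> + (real T * \<eta>)\<^sup>2"
  let ?A = "{u. u < n \<and> e / 2 < \<bar>decode n (encode L n (y u)) - m\<bar>}"
  have far: "(e / 4)\<^sup>2 \<le> (y u - m)\<^sup>2" if "u \<in> ?A" for u
  proof -
    have "y u \<in> {0..1}" using I that by (simp add: drift_bounded_def y_def)
    then have "\<bar>decode n (encode L n (y u)) - y u\<bar> \<le> 1 / real n"
      using decode_encode_le[OF n] decode_encode_ge[OF n] by (auto simp: abs_le_iff algebra_simps)
    also have "\<dots> \<le> e / 4" using e by simp
    finally have "e / 4 \<le> \<bar>y u - m\<bar>" using that by (simp only: mem_Collect_eq) linarith
    then have "(e / 4)\<^sup>2 \<le> \<bar>y u - m\<bar>\<^sup>2" by (rule power_mono) (use e_pos in simp)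
    then show ?thesis by simp
  qed
  have "real (card ?A) * (e / 4)\<^sup>2 = (\<Sum>u\<in>?A. (e / 4)\<^sup>2)" by simp
  also have "\<dots> \<le> (\<Sum>u\<in>?A. (y u - m)\<^sup>2)" by (intro sum_mono far)
  also have "\<dots> \<le> (\<Sum>u<n. (y u - m)\<^sup>2)" by (intro sum_mono2) auto
  also have "\<dots> = real n * mean n (\<lambda>u. (y u - m)\<^sup>2)" using n by (simp add: mean_def)
  also have "\<dots> \<le> real n * W"
    using I \<open>T \<le> t\<close> by (intro mult_left_mono) (simp_all add: drift_bounded_def y_def W_def)
  finally have "real (card ?A) \<le> (16 * W / e\<^sup>2) * real n"
    using e_pos by (simp add: field_simps power2_eq_square)
  also have "\<dots> \<le> (Q - \<beta>) * real n"
    using Q by (intro mult_right_mono) (simp_all add: W_def)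
  finally show ?thesis by (simp add: y_def)
qed

text \<open>
  A sample misses with conditional probability at most \<open>Q\<close>, independently across the nodes, so
  weighting each miss by \<open>1 / Q\<close> at most doubles the expected weight of a node per round.
\<close>
definition potential :: "real \<Rightarrow> nat \<Rightarrow> (nat \<Rightarrow> nat) list \<times> (nat \<Rightarrow> view) \<Rightarrow> real" where
  "potential \<theta> t s = (if drift_bounded t s then \<Prod>v<n. 1 + \<theta> * (1 / Q) ^ misses m (snd s v) else 0)"

text \<open>Extending \<open>potential\<close> by 0 outside the invariant makes the inequality hold
  from every state, without conditioning: by \<open>drift_bounded_frozen\<close> both sides vanish
  there.\<close>

lemma potential_step:
  assumes t: "T \<le> t" and \<theta>: "0 \<le> \<theta>"
  shows "(\<integral>\<^sup>+s'. ennreal (potential \<theta> (Suc t) s') \<partial>gossip_round n algorithm D s)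
    \<le> ennreal (potential (2 * \<theta>) t s)"
proof -
  obtain past w where s: "s = (past, w)" by force
  define B where "B = attacked D (past, w, \<lambda>_. 0)"
  define f where "f = forged D (past, w, \<lambda>_. 0)"
  define w' where "w' = (\<lambda>p. next_views n algorithm w (\<lambda>_. 0) p B (f p))"
  have int: "(\<integral>\<^sup>+s'. ennreal (potential \<theta> (Suc t) s') \<partial>gossip_round n algorithm D s) =
      (\<integral>\<^sup>+p. ennreal (potential \<theta> (Suc t) (p # past, w' p)) \<partial>partners n)"
    by (simp add: s gossip_round_algorithm B_def f_def w'_def)
  have frozen: "drift_bounded (Suc t) (p # past, w' p) \<longleftrightarrow> drift_bounded t s" for p
    unfolding s w'_def by (rule drift_bounded_frozen[OF t])
  show ?thesis
  proof (cases "drift_bounded t s")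
    case False
    then show ?thesis using int frozen by (simp add: potential_def)
  next
    case True
    \<comment> \<open>A forged reply may depend on all partners at once. Counting every attacked
      partner as a miss dominates it by a function of \<open>p v\<close> alone, so that the
      expectation of the product over the nodes factorises.\<close>
    define hit where
      "hit = (\<lambda>j. j \<in> B \<or> e / 2 < \<bar>decode n (encode L n (estimate (w j))) - m\<bar>)"
    define a where "a = (\<lambda>v. \<theta> * (1 / Q) ^ misses m (w v))"
    define h where "h = (\<lambda>v j. 1 + a v * (if hit j then 1 / Q else 1))"
    have a: "0 \<le> a v" for v using \<theta> Q by (simp add: a_def)
    have h: "0 \<le> h v j" for v j using a[of v] Q by (simp add: h_def)
    have len: "T \<le> length (snd (w v))" for v using True t by (simp add: drift_bounded_def s)
    have le: "\<theta> * (1 / Q) ^ misses m (w' p v) \<le> a v * (if hit (p v) then 1 / Q else 1)" for p v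
    proof -
      have "\<theta> * (1 / Q) ^ misses m (w' p v) = a v * (1 / Q) ^ (misses m (w' p v) - misses m (w v))"
        unfolding w'_def misses_next_views[where w = w, OF len] by (simp add: a_def power_add)
      also have "\<dots> \<le> a v * (if hit (p v) then 1 / Q else 1)"
        using Q unfolding w'_def misses_next_views[where w = w, OF len]
        by (intro mult_left_mono a) (auto simp: hit_def)
      finally show ?thesis .
    qed
    have fin_B: "finite B"
      using D finite_subset[of B "{..<n}"] by (auto simp: strong_adversary_def B_def)
    have "card {j. j < n \<and> hit j} \<le> card (B \<union>
        {u. u < n \<and> e / 2 < \<bar>decode n (encode L n (estimate (snd s u))) - m\<bar>})"
      by (intro card_mono) (use fin_B in \<open>auto simp: hit_def s\<close>)
    also have "\<dots> \<le> card B +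
        card {u. u < n \<and> e / 2 < \<bar>decode n (encode L n (estimate (snd s u))) - m\<bar>}"
      by (rule card_Un_le)
    finally have "real (card {j. j < n \<and> hit j}) \<le> real (card B) +
        real (card {u. u < n \<and> e / 2 < \<bar>decode n (encode L n (estimate (snd s u))) - m\<bar>})"
      by linarith
    also have "\<dots> \<le> \<beta> * real n + (Q - \<beta>) * real n"
      using D by (intro add_mono card_misleading[OF True t]) (auto simp: strong_adversary_def B_def)
    finally have hits: "real (card {j. j < n \<and> hit j}) \<le> Q * real n" by (simp add: algebra_simps)
    have avg: "(\<Sum>j<n. h v j) / real n \<le> 1 + 2 * a v" for v
    proof -
      have "(\<Sum>j<n. h v j) \<le> (\<Sum>j<n. (1 + a v) + a v / Q * (if hit j then 1 else 0))"
        using a Q by (intro sum_mono) (auto simp: h_def)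
      also have "\<dots> = real n * (1 + a v) + a v / Q * real (card {j. j < n \<and> hit j})"
        by (simp add: sum.distrib sum.If_cases Int_def flip: sum_distrib_left sum_divide_distrib)
      also have "\<dots> \<le> real n * (1 + a v) + a v / Q * (Q * real n)"
        using a Q by (intro add_left_mono mult_left_mono hits) auto
      also have "\<dots> = real n * (1 + 2 * a v)" using Q by (simp add: field_simps)
      finally show ?thesis using n by (simp add: field_simps)
    qed
    have "(\<integral>\<^sup>+p. ennreal (potential \<theta> (Suc t) (p # past, w' p)) \<partial>partners n) \<le>
        (\<integral>\<^sup>+p. ennreal (\<Prod>v<n. h v (p v)) \<partial>partners n)"
      using True frozen le \<theta> Q
      by (intro nn_integral_mono ennreal_leI)
         (auto simp: potential_def h_def intro!: prod_mono add_nonneg_nonneg)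
    also have "\<dots> = ennreal (measure_pmf.expectation (partners n) (\<lambda>p. \<Prod>v<n. h v (p v)))"
      using h n by (intro nn_integral_eq_integral AE_I2 prod_nonneg integrable_measure_pmf_finite
          finite_set_pmf_partners) auto
    also have "measure_pmf.expectation (partners n) (\<lambda>p. \<Prod>v<n. h v (p v)) =
        (\<Prod>v<n. (\<Sum>j<n. h v j) / real n)"
      by (rule partners_expectation_prod[OF n(1) h])
    also have "\<dots> \<le> (\<Prod>v<n. 1 + 2 * a v)"
      using h avg by (intro prod_mono) (auto intro!: sum_nonneg divide_nonneg_nonneg)
    also have "\<dots> = potential (2 * \<theta>) t s"
      using True by (simp add: potential_def a_def s mult.assoc)
    finally show ?thesis using int by (simp add: ennreal_leI)
  qed
qed

text \<open>The induction peels off the last round, which doubles \<theta>; hence \<theta> is kept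
  arbitrary. At time \<open>T\<close> no sample has been taken, so every node has weight
  \<theta>.\<close>

lemma potential_run:
  assumes "0 \<le> \<theta>"
  shows "(\<integral>\<^sup>+s. ennreal (potential \<theta> (T + j) s) \<partial>run n algorithm D x (T + j))
    \<le> ennreal ((1 + 2 ^ j * \<theta>) ^ n)"
  using assms
proof (induction j arbitrary: \<theta>)
  case 0
  have "potential \<theta> T s \<le> (1 + \<theta>) ^ n" for s
    using 0 by (simp add: potential_def drift_bounded_def misses_def)
  then have "(\<integral>\<^sup>+s. ennreal (potential \<theta> T s) \<partial>run n algorithm D x T) \<le>
      (\<integral>\<^sup>+s. ennreal ((1 + \<theta>) ^ n) \<partial>run n algorithm D x T)"
    by (intro nn_integral_mono ennreal_leI)
  then show ?case by simp
next
  case (Suc j)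
  have "(\<integral>\<^sup>+s. ennreal (potential \<theta> (T + Suc j) s) \<partial>run n algorithm D x (T + Suc j)) \<le>
      (\<integral>\<^sup>+s. ennreal (potential (2 * \<theta>) (T + j) s) \<partial>run n algorithm D x (T + j))"
    using Suc.prems by (simp add: nn_integral_mono potential_step)
  also have "\<dots> \<le> ennreal ((1 + 2 ^ j * (2 * \<theta>)) ^ n)" by (rule Suc.IH) (use Suc.prems in simp)
  finally show ?case by (simp add: mult_ac)
qed

text \<open>Markov's inequality for \<open>potential\<close>, started with \<theta> scaled by
  \<open>sqrt Q ^ k\<close>: then k/2 misses, weighted by 1/Q each, bring the weight of a node back
  to at least \<theta>, so each such node contributes a factor of at least 1 + \<theta>.\<close>

lemma prob_many_misses:
  assumes \<theta>: "0 \<le> \<theta>"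
  shows "measure_pmf.prob (run n algorithm D x (T + k)) {s. drift_bounded (T + k) s \<and>
      a \<le> real (card {v. v < n \<and> k \<le> 2 * misses m (snd s v)})}
    \<le> (1 + \<theta> * (2 * sqrt Q) ^ k) ^ n / (1 + \<theta>) powr a"
    (is "measure_pmf.prob ?run ?E \<le> _")
proof -
  have weight: "1 \<le> sqrt Q ^ k * (1 / Q) ^ c" if "k \<le> 2 * c" for c
  proof -
    have "sqrt Q ^ (2 * c) \<le> sqrt Q ^ k"
      using Q that by (intro power_decreasing) auto
    moreover have "sqrt Q ^ (2 * c) = Q ^ c" using Q by (simp add: power_mult)
    ultimately show ?thesis using Q by (simp add: power_divide field_simps)
  qed
  have large: "(1 + \<theta>) powr a \<le> potential (\<theta> * sqrt Q ^ k) (T + k) s" if "s \<in> ?E" for s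
  proof -
    let ?A = "{v. v < n \<and> k \<le> 2 * misses m (snd s v)}"
    have "(1 + \<theta>) powr a \<le> (1 + \<theta>) powr real (card ?A)"
      using that \<theta> by (intro powr_mono) auto
    also have "\<dots> = (1 + \<theta>) ^ card ?A" using \<theta> by (simp add: powr_realpow)
    also have "\<dots> = (\<Prod>v<n. if v \<in> ?A then 1 + \<theta> else 1)"
      by (simp add: prod.If_cases Int_def)
    also have "\<dots> \<le> (\<Prod>v<n. 1 + \<theta> * sqrt Q ^ k * (1 / Q) ^ misses m (snd s v))"
    proof (intro prod_mono)
      fix v assume "v \<in> {..<n}"
      have "0 \<le> \<theta> * sqrt Q ^ k * (1 / Q) ^ misses m (snd s v)" using \<theta> Q by simp
      moreover have "\<theta> * 1 \<le> \<theta> * (sqrt Q ^ k * (1 / Q) ^ misses m (snd s v))" if "v \<in> ?A"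
        using that \<theta> by (intro mult_left_mono weight) auto
      ultimately show "0 \<le> (if v \<in> ?A then 1 + \<theta> else 1) \<and>
          (if v \<in> ?A then 1 + \<theta> else 1) \<le> 1 + \<theta> * sqrt Q ^ k * (1 / Q) ^ misses m (snd s v)"
        using \<theta> by (auto simp: mult.assoc)
    qed
    also have "\<dots> = potential (\<theta> * sqrt Q ^ k) (T + k) s"
      using that by (simp add: potential_def)
    finally show ?thesis .
  qed
  have "ennreal ((1 + \<theta>) powr a) * emeasure ?run ?E =
      (\<integral>\<^sup>+s. ennreal ((1 + \<theta>) powr a) * indicator ?E s \<partial>?run)"
    by (subst nn_integral_cmult_indicator) auto
  also have "\<dots> \<le> (\<integral>\<^sup>+s. ennreal (potential (\<theta> * sqrt Q ^ k) (T + k) s) \<partial>?run)"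
    by (intro nn_integral_mono) (use large in \<open>auto simp: indicator_def intro!: ennreal_leI\<close>)
  also have "\<dots> \<le> ennreal ((1 + 2 ^ k * (\<theta> * sqrt Q ^ k)) ^ n)"
    by (rule potential_run) (use \<theta> Q in simp)
  finally have "(1 + \<theta>) powr a * measure_pmf.prob ?run ?E \<le> (1 + \<theta> * (2 * sqrt Q) ^ k) ^ n"
    using \<theta> Q by (simp add: measure_pmf.emeasure_eq_measure power_mult_distrib mult_ac flip: ennreal_mult)
  moreover have "0 < (1 + \<theta>) powr a" using \<theta> by simp
  ultimately show ?thesis by (simp add: field_simps)
qed

lemma prob_correct:
  assumes \<theta>: "0 \<le> \<theta>" and \<gamma>: "0 \<le> \<gamma>"
  shows "measure_pmf.prob (outputs n algorithm D x) {y. mean_correctness_level n e M \<gamma> x y} \<ge>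
    1 - (3 * real T * exp (- 2 * real n * \<delta>\<^sup>2) +
         (1 + \<theta> * (2 * sqrt Q) ^ k) ^ n / (1 + \<theta>) powr max 1 (\<gamma> * real n))"
proof -
  let ?run = "run n algorithm D x (T + k)"
  let ?a = "max 1 (\<gamma> * real n)"
  let ?E = "{s. drift_bounded (T + k) s \<and> ?a \<le> real (card {v. v < n \<and> k \<le> 2 * misses m (snd s v)})}"
  let ?C = "{s. mean_correctness_level n e M \<gamma> x (\<lambda>v. result algorithm (snd s v))}"
  have correct: "s \<in> ?C" if I: "drift_bounded (T + k) s" and "s \<notin> ?E" for s
  proof -
    let ?A = "{v. v < n \<and> k \<le> 2 * misses m (snd s v)}"
    let ?W = "{v. v < n \<and> \<not> \<bar>result algorithm (snd s v) - mean n x\<bar> \<le> e * M}"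
    have "real (card ?A) < ?a" using that by (simp only: mem_Collect_eq not_le de_Morgan_conj) blast
    then have card_A: "real (card ?A) \<le> \<gamma> * real n"
    \<comment> \<open>If \<gamma>n < 1, no node may err. The threshold is then 1, and a count below
      1 is 0.\<close>
    proof (cases "1 \<le> \<gamma> * real n")
      case False
      then have "card ?A = 0" using \<open>real (card ?A) < ?a\<close> by linarith
      then show ?thesis using \<gamma> by (simp only: of_nat_0 mult_nonneg_nonneg of_nat_0_le_iff)
    qed linarith
    have "?W \<subseteq> ?A"
    proof (intro subsetI CollectI conjI)
      fix v assume v: "v \<in> ?W"
      then show "v < n" by simp
      show "k \<le> 2 * misses m (snd s v)"
      proof (rule ccontr)
        assume "\<not> ?thesis"
        then have few: "2 * misses m (snd s v) < k" by simp
        have len: "length (snd (snd s v)) = T + k" using I by (simp add: drift_bounded_def)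
        let ?rs = "take k (snd (snd s v))"
        have "\<bar>majority_value ?rs - m\<bar> \<le> e"
          by (rule majority_value_close) (use few len in \<open>simp_all add: misses_def\<close>)
        then have "M * \<bar>majority_value ?rs - m\<bar> \<le> M * e"
          using M_nonneg by (intro mult_left_mono)
        then have "\<bar>M * majority_value ?rs - M * m\<bar> \<le> e * M"
          using M_nonneg by (simp add: abs_mult mult.commute flip: right_diff_distrib)
        moreover have "majority_value (snd (snd s v)) = majority_value ?rs"
          by (simp add: majority_value_def)
        ultimately show False using v by (simp add: algorithm_def scaled_mean)
      qed
    qed
    then have "card ?W \<le> card ?A" by (intro card_mono) auto
    then show ?thesis using card_A by (simp add: mean_correctness_level_def)
  qed
  have "1 - measure_pmf.prob ?run ?C = measure_pmf.prob ?run (- ?C)"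
    by (subst measure_pmf.prob_compl[symmetric]) (auto simp: Compl_eq_Diff_UNIV)
  also have "\<dots> \<le> measure_pmf.prob ?run ({s. \<not> drift_bounded (T + k) s} \<union> ?E)"
    by (rule measure_pmf.finite_measure_mono) (use correct in auto)
  also have "\<dots> \<le> measure_pmf.prob ?run {s. \<not> drift_bounded (T + k) s} + measure_pmf.prob ?run ?E"
    by (rule measure_Un_le) auto
  also have "\<dots> \<le> 3 * real T * exp (- 2 * real n * \<delta>\<^sup>2) +
      (1 + \<theta> * (2 * sqrt Q) ^ k) ^ n / (1 + \<theta>) powr ?a"
    by (intro add_mono prob_drift_bounded prob_many_misses \<theta>)
  finally have "1 - (3 * real T * exp (- 2 * real n * \<delta>\<^sup>2) +
      (1 + \<theta> * (2 * sqrt Q) ^ k) ^ n / (1 + \<theta>) powr ?a) \<le> measure_pmf.prob ?run ?C"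
    by linarith
  moreover have "rounds algorithm = T + k" by (simp add: algorithm_def)
  ultimately show ?thesis
    by (simp add: outputs_def vimage_def case_prod_unfold)
qed

end

text \<open>
  The cut-offs at powers of \<open>n\<close> keep the levels above the sampling noise of a single round;
  correctness level \<open>1 / n\<close> already means that no node errs.
\<close>
definition floor_level :: "nat \<Rightarrow> real \<Rightarrow> real \<Rightarrow> real" where
  "floor_level n \<beta> \<gamma> = max (max \<beta> \<gamma>) (real n powr (- 1 / 8))"

text \<open>Chosen so that 2^T \<ge> 4096 / (\<epsilon>^2 s), where s is the floor level.
  Chebyshev's factor 16/\<epsilon>^2 then leaves s/256 of the initial deviation.\<close>

definition averaging_rounds :: "nat \<Rightarrow> real \<Rightarrow> real \<Rightarrow> real \<Rightarrow> nat" where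
  "averaging_rounds n \<epsilon> \<beta> \<gamma> = nat \<lceil>2 * log 2 (1 / \<epsilon>) + log 2 (1 / floor_level n \<beta> \<gamma>)\<rceil> + 12"

text \<open>The exponent 1/5 is what remains of \<beta> once \<beta> powr (4/5) has paid for
  \<epsilon>^2. The divisor 64 keeps 4Q at most 1/16, so that 2 sqrt Q, the base of the tail bound,
  is bounded away from 1.\<close>

definition misleading_level :: "nat \<Rightarrow> real \<Rightarrow> real \<Rightarrow> real" where
  "misleading_level n \<beta> \<gamma> = floor_level n \<beta> \<gamma> powr (1 / 5) / 64"

text \<open>Solves (4Q)^(k/2) \<le> g^2/4 for k, where g is the maximum of \<gamma> and 1/n. One
  factor g is spent against the weight 4/g in the tail bound, the other one remains there.\<close>

definition sampling_rounds :: "nat \<Rightarrow> real \<Rightarrow> real \<Rightarrow> nat" where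
  "sampling_rounds n \<beta> \<gamma> =
    nat \<lceil>2 * ln (4 / (max \<gamma> (1 / real n))\<^sup>2) / ln (1 / (4 * misleading_level n \<beta> \<gamma>))\<rceil>"

section \<open>Numerical estimates for the chosen parameters\<close>

lemma log2_le: "1 \<le> y \<Longrightarrow> log 2 y \<le> 3 / 2 * ln y" for y :: real
proof -
  assume "1 \<le> y"
  then have "0 \<le> ln y" by simp
  then have "ln y * 1 \<le> ln y * (3 / 2 * ln 2)"
    using ln2_ge_two_thirds by (intro mult_left_mono) auto
  then show ?thesis by (simp add: log_def field_simps)
qed

locale parameters =
  fixes n :: nat and \<epsilon> \<beta> \<gamma> :: real
  assumes n: "0 < n"
    and \<epsilon>: "0 < \<epsilon>" "\<epsilon> < 1 / 2"
    and \<beta>: "0 < \<beta>" "\<beta> \<le> (\<epsilon> / 100) powr (5 / 2)"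
    and \<gamma>: "0 < \<gamma>" "\<gamma> < 1"
begin

abbreviation "s \<equiv> floor_level n \<beta> \<gamma>"
abbreviation "T \<equiv> averaging_rounds n \<epsilon> \<beta> \<gamma>"
abbreviation "Q \<equiv> misleading_level n \<beta> \<gamma>"
abbreviation "k \<equiv> sampling_rounds n \<beta> \<gamma>"
abbreviation "g \<equiv> max \<gamma> (1 / real n)"

lemma \<beta>_small: "\<beta> \<le> 1 / 40000"
proof -
  have "\<beta> \<le> (\<epsilon> / 100) powr 2"
    using \<beta> \<epsilon> powr_mono'[of 2 "5/2" "\<epsilon> / 100"] by simp
  also have "\<dots> \<le> (1 / 200) powr 2" using \<epsilon> by (intro powr_mono2) auto
  finally show ?thesis by (simp add: power2_eq_square)
qed

lemma s: "0 < s" "s \<le> 1" "\<beta> \<le> s" "\<gamma> \<le> s" "real n powr (- 1 / 8) \<le> s"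
proof -
  have "real n powr (- 1 / 8) \<le> 1" using n powr_mono[of "- 1 / 8" 0 "real n"] by simp
  then show "0 < s" "s \<le> 1" "\<beta> \<le> s" "\<gamma> \<le> s" "real n powr (- 1 / 8) \<le> s"
    using \<beta> \<beta>_small \<gamma> by (auto simp: floor_level_def)
qed

lemma log_\<epsilon>: "0 \<le> log 2 (1 / \<epsilon>)"
  using \<epsilon> by simp

lemma log_s: "0 \<le> log 2 (1 / s)"
  using s by simp

lemma T_le: "real T \<le> 13 + 2 * log 2 (1 / \<epsilon>) + log 2 (1 / s)"
  using log_\<epsilon> log_s unfolding averaging_rounds_def by linarith

lemma power_T: "(1 / 2) ^ T \<le> \<epsilon>\<^sup>2 * s / 4096"
proof -
  have "2 * log 2 (1 / \<epsilon>) + log 2 (1 / s) + 12 \<le> real T"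
    unfolding averaging_rounds_def by linarith
  moreover have "2 * log 2 (1 / \<epsilon>) + log 2 (1 / s) + 12 = log 2 (4096 / (\<epsilon>\<^sup>2 * s))"
  proof -
    have "log 2 (4096 :: real) = 12"
      using log_pow_cancel[of 2 12] by simp
    then show ?thesis
      using \<epsilon> s by (simp add: log_divide log_mult log_nat_power)
  qed
  ultimately have "2 powr log 2 (4096 / (\<epsilon>\<^sup>2 * s)) \<le> 2 powr real T" by simp
  then have "4096 / (\<epsilon>\<^sup>2 * s) \<le> 2 ^ T" using \<epsilon> s by (simp add: powr_realpow)
  then show ?thesis using \<epsilon> s by (simp add: power_divide field_simps)
qed

lemma Q: "0 < Q" "Q \<le> 1" "4 * Q < 1" "ln (1 / (4 * Q)) = ln 16 + 1 / 5 * ln (1 / s)"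
proof -
  have "0 < s powr (1 / 5)" "s powr (1 / 5) \<le> 1" using s by (auto intro!: powr_le1)
  then show "0 < Q" "Q \<le> 1" "4 * Q < 1" by (auto simp: misleading_level_def)
  have "ln (1 / (4 * Q)) = ln (16 / s powr (1 / 5))" by (simp add: misleading_level_def)
  also have "\<dots> = ln 16 + 1 / 5 * ln (1 / s)"
    using s by (simp add: ln_div)
  finally show "ln (1 / (4 * Q)) = ln 16 + 1 / 5 * ln (1 / s)" .
qed

lemma g: "0 < g" "g \<le> 1" "g * real n = max 1 (\<gamma> * real n)"
  using \<gamma> n by (auto simp: max_def field_simps)

text \<open>The additive constants are absorbed by ln (1/\<epsilon>) \<ge> 2/3. The second logarithm
  can be negative, since \<gamma> + \<beta> may exceed 1, but only slightly because \<beta> is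
  tiny.\<close>

lemma rounds_le:
  "real (T + k) \<le> 400 * (ln (1 / \<epsilon>) + ln (1 / (\<gamma> + \<beta>)) + ln (1 / \<gamma>) / ln (1 / \<beta>))"
proof -
  define E where "E = ln (1 / \<epsilon>)"
  define G where "G = ln (1 / (\<gamma> + \<beta>))"
  define X where "X = ln (1 / \<gamma>) / ln (1 / \<beta>)"
  define d where "d = ln (1 / (4 * Q))"
  have "ln 2 \<le> E" unfolding E_def using \<epsilon> by (subst ln_le_cancel_iff) (auto simp: field_simps)
  then have E: "2 / 3 \<le> E" using ln2_ge_two_thirds by linarith
  have "ln (\<gamma> + \<beta>) \<le> \<gamma> + \<beta> - 1" using \<beta> \<gamma> by (intro ln_le_minus_one) auto
  then have G: "- 1 / 10 \<le> G" using \<beta> \<beta>_small \<gamma> by (simp add: G_def ln_div)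
  have ln\<gamma>: "0 \<le> ln (1 / \<gamma>)" using \<gamma> by simp
  have ln\<beta>: "0 < ln (1 / \<beta>)" using \<beta> \<beta>_small by simp
  have X: "0 \<le> X" unfolding X_def using ln\<gamma> ln\<beta> by simp
  \<comment> \<open>The maximum of \<beta> and \<gamma> is at least half their sum.\<close>
  have "1 / s \<le> 2 / (\<gamma> + \<beta>)" using s \<gamma> \<beta> by (simp add: field_simps)
  then have "ln (1 / s) \<le> ln (2 / (\<gamma> + \<beta>))" using s \<gamma> \<beta> by (subst ln_le_cancel_iff) auto
  also have "\<dots> = ln 2 + G" using \<gamma> \<beta> by (simp add: G_def ln_div)
  also have "\<dots> \<le> 1 + G" using ln_2_less_1 by simp
  finally have "ln (1 / s) \<le> 1 + G" .
  moreover have ge1: "1 \<le> 1 / \<epsilon>" "1 \<le> 1 / s" using \<epsilon> s by simp_all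
  ultimately have "real T \<le> 13 + 3 * E + 3 / 2 * (1 + G)"
    using T_le log2_le[OF ge1(1)] log2_le[OF ge1(2)] unfolding E_def by argo
  moreover have "real k \<le> 162 + 20 * X"
  proof -
    have lns: "0 \<le> ln (1 / s)" using s by simp
    have ln16: "0 < ln (16 :: real)" by simp
    have d: "ln 16 \<le> d" "1 / 5 * ln (1 / s) \<le> d"
      unfolding d_def Q(4) using lns by simp_all
    with ln16 have "0 < d" by linarith
    note d = d this
    have lng: "0 \<le> ln (1 / g)" using g by simp
    have "2 * ln (4 / g\<^sup>2) = ln 16 + 4 * ln (1 / g)"
    proof -
      have "ln (16 :: real) = 2 * ln 4" using ln_realpow[of 4 2] by simp
      then show ?thesis using g by (simp add: ln_div ln_realpow del: max_less_iff_conj less_max_iff_disj)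
    qed
    moreover have "real k \<le> 1 + 2 * ln (4 / g\<^sup>2) / d"
      if "0 \<le> 2 * ln (4 / g\<^sup>2) / d"
      using that unfolding sampling_rounds_def d_def by linarith
    ultimately have "real k \<le> 1 + (ln 16 + 4 * ln (1 / g)) / d"
      using d lng ln16 by simp
    also have "\<dots> \<le> 2 + 4 * ln (1 / g) / d" using d by (simp add: add_divide_distrib)
    also have "4 * ln (1 / g) / d \<le> 160 + 20 * X"
    proof -
      \<comment> \<open>The three candidates for the maximum \<open>s\<close>. If it is the cut-off,
        then d \<ge> ln n / 40 while ln (1/g) \<le> ln n, which gives 160; if it is \<gamma>, the
        quotient is bounded as well; only \<beta> leads to the quotient of logarithms
        \<open>X\<close>.\<close>
      have "s = real n powr (- 1 / 8) \<or> s = \<gamma> \<or> s = \<beta>"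
        by (simp add: floor_level_def max_def)
      then consider "s = real n powr (- 1 / 8)" | "s = \<gamma>" | "s = \<beta>" by blast
      then show ?thesis
      proof cases
        case 1
        have "ln (1 / g) \<le> ln (real n)"
          using g n by (subst ln_le_cancel_iff) (auto simp: field_simps max_def)
        moreover have "ln (1 / s) = ln (real n) / 8" using n by (simp add: 1 ln_div)
        ultimately have "4 * ln (1 / g) \<le> 160 * d" using d by linarith
        then have "4 * ln (1 / g) / d \<le> 160" using d by (simp add: divide_le_eq)
        then show ?thesis using X by linarith
      next
        case 2
        have "ln (1 / g) \<le> ln (1 / \<gamma>)"
          using g \<gamma> by (subst ln_le_cancel_iff) (auto simp: field_simps max_def)
        then have "4 * ln (1 / g) \<le> 160 * d" using d 2 by simp
        then have "4 * ln (1 / g) / d \<le> 160" using d by (simp add: divide_le_eq)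
        then show ?thesis using X by linarith
      next
        case 3
        have "ln (1 / g) \<le> ln (1 / \<gamma>)"
          using g \<gamma> by (subst ln_le_cancel_iff) (auto simp: field_simps max_def)
        then have "4 * ln (1 / g) / d \<le> 4 * ln (1 / \<gamma>) / (1 / 5 * ln (1 / \<beta>))"
          using d 3 ln\<beta> ln\<gamma> by (intro frac_le) auto
        then show ?thesis by (simp add: X_def)
      qed
    qed
    finally show ?thesis by linarith
  qed
  ultimately show ?thesis using E G X unfolding E_def[symmetric] G_def[symmetric] X_def[symmetric]
      of_nat_add by argo
qed

lemma sampling_power: "(2 * sqrt Q) ^ k \<le> g\<^sup>2 / 4"
proof -
  define d where "d = ln (1 / (4 * Q))"
  have d: "0 < d" unfolding d_def using Q(1,3) by simp
  have pos: "0 < 2 * sqrt Q" using Q by simp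
  have "2 * ln (4 / g\<^sup>2) / d \<le> real k" unfolding sampling_rounds_def d_def by linarith
  then have "2 * ln (4 / g\<^sup>2) \<le> real k * d" using d by (simp add: divide_le_eq)
  moreover have "ln (2 * sqrt Q) = - d / 2"
    using Q(1) by (simp add: d_def ln_mult ln_sqrt ln_div) (use ln_realpow[of 2 2] in simp)
  moreover have "ln (4 / g\<^sup>2) = - ln (g\<^sup>2 / 4)" using g by (simp add: ln_div del: less_max_iff_disj)
  ultimately have "ln ((2 * sqrt Q) ^ k) \<le> ln (g\<^sup>2 / 4)"
    unfolding ln_realpow by simp
  then show ?thesis using pos g by (subst (asm) ln_le_cancel_iff) (simp_all del: less_max_iff_disj)
qed

text \<open>For \<theta> = 4/g the numerator is at most exp (gn) and the denominator at least
  (4/g)^(gn). Since ln 4 \<ge> 4/3 exceeds 1, the quotient is at most exp (- (1/3 + ln (1/g))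
  gn).\<close>

lemma sampling_failure:
  "(1 + 4 / g * (2 * sqrt Q) ^ k) ^ n / (1 + 4 / g) powr max 1 (\<gamma> * real n)
    \<le> exp (- sqrt (real n) / 3) + real n powr (- 1 / 2)"
proof -
  define h where "h = g"
  have h: "0 < h" "h \<le> 1" "max 1 (\<gamma> * real n) = h * real n" using g by (simp_all add: h_def)
  have h1: "1 \<le> h * real n" using h(3) by linarith
  have p: "0 \<le> (2 * sqrt Q) ^ k" "(2 * sqrt Q) ^ k \<le> h\<^sup>2 / 4"
    using Q sampling_power by (simp_all add: h_def)
  have "4 / h * (2 * sqrt Q) ^ k \<le> 4 / h * (h\<^sup>2 / 4)"
    using h p by (intro mult_left_mono) auto
  also have "\<dots> = h" using h by (simp add: power2_eq_square)
  finally have "1 + 4 / h * (2 * sqrt Q) ^ k \<le> exp h" using exp_ge_add_one_self[of h] by linarith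
  then have "(1 + 4 / h * (2 * sqrt Q) ^ k) ^ n \<le> exp h ^ n"
    using h p by (intro power_mono) auto
  also have "exp h ^ n = exp (h * real n)" by (rule exp_of_nat2_mult[symmetric])
  finally have num: "(1 + 4 / h * (2 * sqrt Q) ^ k) ^ n \<le> exp (h * real n)" .
  have ln4h: "4 / 3 + ln (1 / h) \<le> ln (4 / h)"
  proof -
    have "ln (4 :: real) = 2 * ln 2" using ln_realpow[of 2 2] by simp
    then show ?thesis using ln2_ge_two_thirds h by (simp add: ln_div)
  qed
  have "exp ((4 / 3 + ln (1 / h)) * (h * real n)) \<le> exp (ln (4 / h) * (h * real n))"
    using ln4h h by (intro iffD2[OF exp_le_cancel_iff] mult_right_mono) auto
  also have "\<dots> = (4 / h) powr (h * real n)" using h by (simp add: powr_def mult.commute)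
  also have "\<dots> \<le> (1 + 4 / h) powr (h * real n)" using h by (intro powr_mono2) auto
  finally have den: "exp ((4 / 3 + ln (1 / h)) * (h * real n)) \<le> (1 + 4 / h) powr (h * real n)" .
  have "(1 + 4 / h * (2 * sqrt Q) ^ k) ^ n / (1 + 4 / h) powr (h * real n) \<le>
      exp (h * real n) / exp ((4 / 3 + ln (1 / h)) * (h * real n))"
    using num den by (intro frac_le) auto
  also have "\<dots> = exp (- (1 / 3 + ln (1 / h)) * (h * real n))"
    by (simp add: algebra_simps flip: exp_diff)
  \<comment> \<open>For h \<ge> 1 / sqrt n the summand 1/3 alone yields the exponent sqrt n / 3. For
    smaller h the product hn is only known to be at least 1, but then ln (1/h) \<ge> ln n / 2
    suffices.\<close>
  also have "\<dots> \<le> exp (- sqrt (real n) / 3) + real n powr (- 1 / 2)"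
  proof (cases "1 / sqrt (real n) \<le> h")
    case True
    have lnh: "0 \<le> ln (1 / h)" using h by simp
    have "sqrt (real n) = 1 / sqrt (real n) * real n" using n by (simp add: real_div_sqrt)
    also have "\<dots> \<le> h * real n" using True by (intro mult_right_mono) auto
    finally have "1 / 3 * sqrt (real n) \<le> (1 / 3 + ln (1 / h)) * (h * real n)"
      using lnh by (intro mult_mono) auto
    then have "exp (- (1 / 3 + ln (1 / h)) * (h * real n)) \<le> exp (- sqrt (real n) / 3)"
      by (simp only: exp_le_cancel_iff mult_minus_left)
    then show ?thesis by (simp add: add_increasing2)
  next
    case False
    then have "sqrt (real n) \<le> 1 / h" using h n by (simp add: field_simps)
    then have "ln (sqrt (real n)) \<le> ln (1 / h)" using h n by (subst ln_le_cancel_iff) auto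
    then have "1 / 2 * ln (real n) \<le> (1 / 3 + ln (1 / h)) * 1" using n by (simp add: ln_sqrt)
    also have "\<dots> \<le> (1 / 3 + ln (1 / h)) * (h * real n)"
      using h h1 by (intro mult_left_mono add_nonneg_nonneg) auto
    finally have "exp (- (1 / 3 + ln (1 / h)) * (h * real n)) \<le> exp (- 1 / 2 * ln (real n))"
      by (simp only: exp_le_cancel_iff mult_minus_left minus_divide_left[symmetric] neg_le_iff_le)
    also have "\<dots> = real n powr (- 1 / 2)" using n by (simp add: powr_def)
    finally show ?thesis by (simp add: add_increasing)
  qed
  finally show ?thesis unfolding h(3) h_def .
qed

text \<open>Both logarithms in \<open>T\<close> are O(ln (1/\<beta>)), because \<beta> powr (2/5)
  \<le> \<epsilon> and \<beta> \<le> s. Writing \<beta> = u^4 and using ln (1/u) \<le> 1/u - 1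
  reduces the claim to a polynomial inequality for u \<le> 9/100.\<close>

lemma T_sq_\<beta>: "(real T)\<^sup>2 * \<beta> \<le> 1"
proof -
  define u where "u = \<beta> powr (1 / 4)"
  have u: "0 < u" "u ^ 4 = \<beta>"
    using \<beta> by (simp_all add: u_def powr_powr flip: powr_realpow)
  have "u ^ 4 \<le> (9 / 100) ^ 4" using u \<beta>_small by (simp add: power_divide)
  then have u_small: "u \<le> 9 / 100" by (subst (asm) power_mono_iff) (use u in auto)
  have "\<beta> powr (2 / 5) \<le> ((\<epsilon> / 100) powr (5 / 2)) powr (2 / 5)"
    using \<beta> by (intro powr_mono2) auto
  also have "\<dots> = \<epsilon> / 100" using \<epsilon> by (simp add: powr_powr)
  finally have \<epsilon>_ge: "\<beta> powr (2 / 5) \<le> \<epsilon>" using \<epsilon> by linarith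
  have "ln (1 / \<epsilon>) \<le> ln (1 / \<beta> powr (2 / 5))"
    using \<epsilon>_ge \<epsilon> \<beta> by (subst ln_le_cancel_iff) (auto simp: frac_le)
  also have "\<dots> = 2 / 5 * ln (1 / \<beta>)" using \<beta> by (simp add: ln_div)
  finally have "ln (1 / \<epsilon>) \<le> 2 / 5 * ln (1 / \<beta>)" .
  moreover have "ln (1 / s) \<le> ln (1 / \<beta>)"
    using s \<beta> by (subst ln_le_cancel_iff) (auto simp: frac_le)
  ultimately have "real T \<le> 13 + 27 / 10 * ln (1 / \<beta>)"
    using T_le log2_le[of "1 / \<epsilon>"] log2_le[of "1 / s"] \<epsilon> s by simp
  moreover have "ln (1 / \<beta>) = 4 * ln (1 / u)" using u by (simp add: ln_div ln_realpow flip: u(2))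
  moreover have "ln (1 / u) \<le> 1 / u - 1" using u by (intro ln_le_minus_one) auto
  ultimately have "real T \<le> 11 / 5 + 54 / 5 * (1 / u)" by linarith
  then have "real T * u\<^sup>2 \<le> (11 / 5 + 54 / 5 * (1 / u)) * u\<^sup>2" by (rule mult_right_mono) simp
  also have "\<dots> = 11 / 5 * (u * u) + 54 / 5 * u" using u by (simp add: power2_eq_square field_simps)
  also have "\<dots> \<le> 11 / 5 * (9 / 100 * (9 / 100)) + 54 / 5 * (9 / 100)"
    using u u_small by (intro add_mono mult_left_mono mult_mono) auto
  also have "\<dots> \<le> 1" by simp
  finally have "(real T * u\<^sup>2)\<^sup>2 \<le> 1" by (intro power_le_one) auto
  then show ?thesis using u by (simp add: power_mult_distrib flip: power_mult)
qed

text \<open>The squared drift is quadratic in \<beta> and \<nu>; as T^2 \<beta> and T^2 \<nu> are at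
  most 1, it drops to linear terms. Then \<beta>/\<epsilon>^2 is compared with r = s powr (1/5)
  through the exponent 5/2, and \<nu>/\<epsilon>^2 \<le> n powr (- 1/20) through r \<ge> n powr (-
  1/40), which the cut-off of \<open>s\<close> guarantees.\<close>

lemma misleading_le:
  assumes \<epsilon>_ge: "real n powr (- 1 / 5) \<le> \<epsilon>"
    and n_large: "(14 + log 2 (real n))\<^sup>2 * real n powr (- 9 / 20) \<le> 1"
      "1 / real n \<le> real n powr (- 9 / 20)"
      "192 * real n powr (- 1 / 20) \<le> 1 / 250 * real n powr (- 1 / 40)"
  defines "\<eta> \<equiv> \<beta> + 1 / real n + real n powr (- 9 / 20)"
  shows "16 * ((1 / 2) ^ T + 2 * \<eta> + (real T * \<eta>)\<^sup>2) / \<epsilon>\<^sup>2 + \<beta> \<le> Q"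
    and "real T \<le> 14 + log 2 (real n)"
proof -
  define \<nu> where "\<nu> = real n powr (- 9 / 20)"
  have \<nu>: "0 \<le> \<nu>" by (simp add: \<nu>_def)
  have log_n: "0 \<le> log 2 (real n)" using n by simp
  have "log 2 (1 / \<epsilon>) \<le> log 2 (1 / real n powr (- 1 / 5))"
    using \<epsilon>_ge \<epsilon> n by (subst log_le_cancel_iff) (auto simp: frac_le)
  also have "\<dots> = 1 / 5 * log 2 (real n)" using n by (simp add: log_divide log_powr)
  finally have 1: "log 2 (1 / \<epsilon>) \<le> 1 / 5 * log 2 (real n)" .
  have "log 2 (1 / s) \<le> log 2 (1 / real n powr (- 1 / 8))"
    using s n by (subst log_le_cancel_iff) (auto simp: frac_le)
  also have "\<dots> = 1 / 8 * log 2 (real n)" using n by (simp add: log_divide log_powr)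
  finally show T_log: "real T \<le> 14 + log 2 (real n)" using 1 T_le log_n by linarith
  have "(real T)\<^sup>2 * \<nu> \<le> (14 + log 2 (real n))\<^sup>2 * \<nu>"
    using T_log \<nu> by (intro mult_right_mono power_mono) auto
  then have T_sq_\<nu>: "(real T)\<^sup>2 * \<nu> \<le> 1" using n_large(1) by (simp add: \<nu>_def)
  have \<eta>: "0 \<le> \<eta>" "\<eta> \<le> \<beta> + 2 * \<nu>" using n_large(2) \<beta> by (simp_all add: \<eta>_def \<nu>_def)
  have "\<eta>\<^sup>2 \<le> (\<beta> + 2 * \<nu>)\<^sup>2" using \<eta> by (intro power_mono) auto
  also have "\<dots> \<le> 2 * \<beta>\<^sup>2 + 8 * \<nu>\<^sup>2"
    using zero_le_power2[of "\<beta> - 2 * \<nu>"] by (simp add: power2_eq_square algebra_simps)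
  finally have "(real T * \<eta>)\<^sup>2 \<le> (real T)\<^sup>2 * (2 * \<beta>\<^sup>2 + 8 * \<nu>\<^sup>2)"
    by (simp add: power_mult_distrib mult_left_mono)
  also have "\<dots> = 2 * \<beta> * ((real T)\<^sup>2 * \<beta>) + 8 * \<nu> * ((real T)\<^sup>2 * \<nu>)"
    by (simp add: power2_eq_square algebra_simps)
  also have "\<dots> \<le> 2 * \<beta> * 1 + 8 * \<nu> * 1"
    using T_sq_\<beta> T_sq_\<nu> \<beta> \<nu> by (intro add_mono mult_left_mono) auto
  finally have "(1 / 2) ^ T + 2 * \<eta> + (real T * \<eta>)\<^sup>2 \<le> \<epsilon>\<^sup>2 * s / 4096 + 4 * \<beta> + 12 * \<nu>"
    using power_T \<eta> by linarith
  then have "16 * ((1 / 2) ^ T + 2 * \<eta> + (real T * \<eta>)\<^sup>2) / \<epsilon>\<^sup>2 \<le>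
      16 * (\<epsilon>\<^sup>2 * s / 4096 + 4 * \<beta> + 12 * \<nu>) / \<epsilon>\<^sup>2"
    by (intro divide_right_mono mult_left_mono) auto
  also have "\<dots> = s / 256 + 64 * (\<beta> / \<epsilon>\<^sup>2) + 192 * (\<nu> / \<epsilon>\<^sup>2)"
    using \<epsilon> by (simp add: field_simps)
  finally have main: "16 * ((1 / 2) ^ T + 2 * \<eta> + (real T * \<eta>)\<^sup>2) / \<epsilon>\<^sup>2 \<le>
    s / 256 + 64 * (\<beta> / \<epsilon>\<^sup>2) + 192 * (\<nu> / \<epsilon>\<^sup>2)" .
  define r where "r = s powr (1 / 5)"
  have s_r: "s \<le> r" using powr_mono'[of "1 / 5" 1 s] s by (simp add: r_def)
  have \<beta>\<epsilon>: "\<beta> / \<epsilon>\<^sup>2 \<le> r / 10000"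
  proof -
    have "\<beta> powr (4 / 5) \<le> ((\<epsilon> / 100) powr (5 / 2)) powr (4 / 5)"
      using \<beta> by (intro powr_mono2) auto
    also have "\<dots> = (\<epsilon> / 100)\<^sup>2" using \<epsilon> by (simp add: powr_powr)
    finally have "\<beta> powr (1 / 5) * \<beta> powr (4 / 5) \<le> \<beta> powr (1 / 5) * (\<epsilon> / 100)\<^sup>2"
      by (rule mult_left_mono) simp
    also have "\<dots> \<le> r * (\<epsilon> / 100)\<^sup>2"
      unfolding r_def using s \<beta> by (intro mult_right_mono powr_mono2) auto
    finally have "\<beta> \<le> r * (\<epsilon> / 100)\<^sup>2" using \<beta> by (simp flip: powr_add)
    then show ?thesis using \<epsilon> by (simp add: power_divide field_simps)
  qed
  have "\<beta> * \<epsilon>\<^sup>2 \<le> \<beta> * 1" using \<epsilon> \<beta> by (intro mult_left_mono power_le_one) auto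
  then have \<beta>_le: "\<beta> \<le> \<beta> / \<epsilon>\<^sup>2" using \<epsilon> by (simp add: field_simps)
  have "\<nu> / \<epsilon>\<^sup>2 \<le> \<nu> / (real n powr (- 1 / 5))\<^sup>2"
    using \<epsilon>_ge \<nu> n \<epsilon> by (intro divide_left_mono power_mono mult_pos_pos zero_less_power) auto
  also have "\<dots> = real n powr (- 1 / 20)"
    using n by (simp add: \<nu>_def powr_power flip: powr_diff)
  finally have "192 * (\<nu> / \<epsilon>\<^sup>2) \<le> 1 / 250 * real n powr (- 1 / 40)" using n_large(3) by linarith
  also have "real n powr (- 1 / 40) = (real n powr (- 1 / 8)) powr (1 / 5)" by (simp add: powr_powr)
  also have "\<dots> \<le> r" unfolding r_def using s by (intro powr_mono2) auto
  finally have \<nu>\<epsilon>: "192 * (\<nu> / \<epsilon>\<^sup>2) \<le> 1 / 250 * r" by simp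
  have "0 \<le> r" by (simp add: r_def)
  \<comment> \<open>The budget in multiples of \<open>r\<close>: 1/256 from halving, 64/10000 from
    the attacks, 1/250 from the noise and at most 1/10000 for the last \<beta>, together below
    1/64.\<close>
  have "Q = r / 64" by (simp add: misleading_level_def r_def)
  then show "16 * ((1 / 2) ^ T + 2 * \<eta> + (real T * \<eta>)\<^sup>2) / \<epsilon>\<^sup>2 + \<beta> \<le> Q"
    using main s_r \<beta>\<epsilon> \<beta>_le \<nu>\<epsilon> \<open>0 \<le> r\<close> by linarith
qed

end

section \<open>The trivial algorithm, and the assembly of both cases\<close>

definition constant_algorithm :: "real \<Rightarrow> gossip_algorithm" where
  "constant_algorithm z = \<lparr>rounds = 0, coin_dist = \<lambda>_. return_pmf 0, act = \<lambda>_ _. Pull,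
     answer = \<lambda>_ _. [], result = \<lambda>_. z\<rparr>"

lemma constant_algorithm_solves_mean:
  assumes n: "0 < n" and e: "1 / 2 \<le> e" and "0 \<le> \<gamma>" "q \<le> 1"
  shows "solves_mean n (constant_algorithm (M / 2)) \<beta> e M \<gamma> q"
  unfolding solves_mean_def
proof (intro allI impI)
  fix x D
  assume x: "\<forall>v<n. x v \<in> {0..M}"
  have M: "0 \<le> M" using x n by force
  have "(\<Sum>v<n. x v) \<le> (\<Sum>v<n. M)" by (intro sum_mono) (use x in auto)
  moreover have "0 \<le> (\<Sum>v<n. x v)" by (intro sum_nonneg) (use x in auto)
  ultimately have "0 \<le> mean n x" "mean n x \<le> M"
    using n by (simp_all add: mean_def divide_le_eq mult.commute)
  moreover have "M / 2 \<le> e * M" using mult_right_mono[OF e M] by simp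
  ultimately have "\<bar>M / 2 - mean n x\<bar> \<le> e * M" by (simp add: abs_le_iff)
  then have "mean_correctness_level n e M \<gamma> x (\<lambda>_. M / 2)"
    using \<open>0 \<le> \<gamma>\<close> by (simp add: mean_correctness_level_def)
  moreover have "outputs n (constant_algorithm (M / 2)) D x = return_pmf (\<lambda>_. M / 2)"
    by (simp add: outputs_def constant_algorithm_def)
  ultimately show "q \<le> measure_pmf.prob (outputs n (constant_algorithm (M / 2)) D x)
      {y. mean_correctness_level n e M \<gamma> x y}"
    using \<open>q \<le> 1\<close> by simp
qed

lemma (in parameters) mean_gossip_solves_mean:
  assumes "real n powr (- 1 / 5) \<le> \<epsilon>"
    and "(14 + log 2 (real n))\<^sup>2 * real n powr (- 9 / 20) \<le> 1"
    and "1 / real n \<le> real n powr (- 9 / 20)"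
    and "192 * real n powr (- 1 / 20) \<le> 1 / 250 * real n powr (- 1 / 40)"
    and n4: "4 / real n \<le> real n powr (- 1 / 5)"
    and fail: "3 * (14 + log 2 (real n)) * exp (- 2 * real n powr (1 / 10)) +
      (exp (- sqrt (real n) / 3) + real n powr (- 1 / 2)) \<le> real n powr (- 1 / 4)"
    and L: "n < 2 ^ L"
  shows "solves_mean n (mean_gossip.algorithm n T k L M \<epsilon>) \<beta> \<epsilon> M \<gamma> (1 - real n powr (- (1 / 4)))"
  unfolding solves_mean_def
proof (intro allI impI)
  fix x D
  assume x: "\<forall>v<n. x v \<in> {0..M}" and D: "strong_adversary n \<beta> D"
  note T = misleading_le[OF assms(1-4)]
  define \<nu> where "\<nu> = real n powr (- 9 / 20)"
  interpret mean_gossip_run n T k L M \<epsilon> D x \<beta> \<nu> Q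
    using n L assms(1) n4 x D Q(1,2) T(1) by unfold_locales (auto simp: \<nu>_def)
  \<comment> \<open>The exponent in Hoeffding's bound is n \<nu>^2 = n powr (1/10), large enough for
    a union bound over logarithmically many averaging rounds.\<close>
  have "real n * \<nu>\<^sup>2 = real n powr 1 * real n powr (- 9 / 10)"
    using n by (simp add: \<nu>_def powr_power)
  then have \<nu>: "- 2 * real n * \<nu>\<^sup>2 = - 2 * real n powr (1 / 10)"
    unfolding powr_add[symmetric] by simp
  have "3 * real T * exp (- 2 * real n * \<nu>\<^sup>2) \<le> 3 * (14 + log 2 (real n)) * exp (- 2 * real n powr (1 / 10))"
    unfolding \<nu> using T(2) by (intro mult_right_mono) auto
  then have "3 * real T * exp (- 2 * real n * \<nu>\<^sup>2) +
      (1 + 4 / g * (2 * sqrt Q) ^ k) ^ n / (1 + 4 / g) powr max 1 (\<gamma> * real n) \<le> real n powr (- 1 / 4)"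
    using sampling_failure fail by linarith
  then have "1 - real n powr (- 1 / 4) \<le> 1 - (3 * real T * exp (- 2 * real n * \<nu>\<^sup>2) +
      (1 + 4 / g * (2 * sqrt Q) ^ k) ^ n / (1 + 4 / g) powr max 1 (\<gamma> * real n))"
    by linarith
  also have "\<dots> \<le> measure_pmf.prob (outputs n algorithm D x) {y. mean_correctness_level n \<epsilon> M \<gamma> x y}"
    by (rule prob_correct) (use \<gamma> g in auto)
  finally show "1 - real n powr (- (1 / 4)) \<le>
      measure_pmf.prob (outputs n algorithm D x) {y. mean_correctness_level n \<epsilon> M \<gamma> x y}"
    by simp
qed

theorem theorem3:
  fixes \<epsilon> \<beta> \<gamma> M :: "nat \<Rightarrow> real"
  assumes "\<And>n. \<epsilon> n \<in> {0<..<1}"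
    and "\<And>n. \<beta> n \<in> {0<..<1}"
    and "\<And>n. \<gamma> n \<in> {0<..<1}"
    and "\<And>n. \<beta> n \<le> (\<epsilon> n / 100) powr (5/2)"
    and "\<epsilon> \<in> \<Omega>(\<lambda>n. ln (real n) powr (6/5) / real n powr (1/5))"
    and "\<And>n. 0 \<le> M n"
    and "\<exists>k::nat. M \<in> O(\<lambda>n. real n ^ k)"
  shows "\<exists>A :: nat \<Rightarrow> gossip_algorithm.
    (\<exists>L :: nat \<Rightarrow> nat. (\<forall>n. message_size_le (A n) (L n)) \<and> (\<lambda>n. real (L n)) \<in> O(\<lambda>n. ln (real n))) \<and>
    (\<lambda>n. real (rounds (A n))) \<in>
      O(\<lambda>n. ln (1 / \<epsilon> n) + ln (1 / (\<gamma> n + \<beta> n)) + ln (1 / \<gamma> n) / ln (1 / \<beta> n)) \<and>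
    (\<exists>c>0. \<forall>\<^sub>F n in sequentially.
      solves_mean n (A n) (\<beta> n) (\<epsilon> n) (M n) (\<gamma> n) (1 - real n powr (- c)))"
proof -
  define L :: "nat \<Rightarrow> nat" where "L = (\<lambda>n. nat \<lceil>log 2 (real n + 1)\<rceil>)"
  define A where "A = (\<lambda>n. if \<epsilon> n < 1 / 2
    then mean_gossip.algorithm n (averaging_rounds n (\<epsilon> n) (\<beta> n) (\<gamma> n))
      (sampling_rounds n (\<beta> n) (\<gamma> n)) (L n) (M n) (\<epsilon> n)
    else constant_algorithm (M n / 2))"
  have parameters: "parameters n (\<epsilon> n) (\<beta> n) (\<gamma> n)" if "0 < n" "\<epsilon> n < 1 / 2" for n
    using that assms(1-4)[of n] by unfold_locales auto
  have L: "n < 2 ^ L n" for n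
  proof -
    have "log 2 (real n + 1) \<le> real (L n)" unfolding L_def by linarith
    then have "real n + 1 \<le> 2 powr real (L n)" by (simp add: log_le_iff)
    then have "real (n + 1) \<le> real (2 ^ L n)" by (simp add: powr_realpow)
    then show ?thesis by (simp only: of_nat_le_iff)
  qed
  have "message_size_le (A n) (L n)" for n
    by (cases "\<epsilon> n < 1 / 2")
       (simp add: A_def mean_gossip.message_size,
        simp add: A_def constant_algorithm_def message_size_le_def)
  moreover have "(\<lambda>n. real (L n)) \<in> O(\<lambda>n. ln (real n))"
  proof (rule bigoI)
    have "\<forall>\<^sub>F n in sequentially. 3 / 2 * ln (real n + 1) + 1 \<le> 4 * ln (real n)" by real_asymp
    then show "\<forall>\<^sub>F n in sequentially. norm (real (L n)) \<le> 4 * norm (ln (real n))"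
    proof (rule eventually_mono)
      fix n assume le: "3 / 2 * ln (real n + 1) + 1 \<le> 4 * ln (real n)"
      have "0 \<le> log 2 (real n + 1)" by simp
      then have "real (L n) \<le> log 2 (real n + 1) + 1" unfolding L_def by linarith
      then show "norm (real (L n)) \<le> 4 * norm (ln (real n))"
        using le log2_le[of "real n + 1"] by simp
    qed
  qed
  moreover have "(\<lambda>n. real (rounds (A n))) \<in>
      O(\<lambda>n. ln (1 / \<epsilon> n) + ln (1 / (\<gamma> n + \<beta> n)) + ln (1 / \<gamma> n) / ln (1 / \<beta> n))"
  proof (rule bigoI)
    show "\<forall>\<^sub>F n in sequentially. norm (real (rounds (A n))) \<le>
      400 * norm (ln (1 / \<epsilon> n) + ln (1 / (\<gamma> n + \<beta> n)) + ln (1 / \<gamma> n) / ln (1 / \<beta> n))"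
      using eventually_gt_at_top[of 0]
    proof (rule eventually_mono)
      fix n :: nat assume n: "0 < n"
      show "norm (real (rounds (A n))) \<le>
        400 * norm (ln (1 / \<epsilon> n) + ln (1 / (\<gamma> n + \<beta> n)) + ln (1 / \<gamma> n) / ln (1 / \<beta> n))"
      proof (cases "\<epsilon> n < 1 / 2")
        case True
        then have "rounds (A n) =
            averaging_rounds n (\<epsilon> n) (\<beta> n) (\<gamma> n) + sampling_rounds n (\<beta> n) (\<gamma> n)"
          by (simp add: A_def mean_gossip.algorithm_def)
        then show ?thesis using parameters.rounds_le[OF parameters[OF n True]] by simp
      next
        case False
        then show ?thesis by (simp add: A_def constant_algorithm_def)
      qed
    qed
  qed
  moreover have "\<forall>\<^sub>F n in sequentially.
      solves_mean n (A n) (\<beta> n) (\<epsilon> n) (M n) (\<gamma> n) (1 - real n powr (- (1 / 4)))"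
  proof -
    obtain c where c: "0 < c" "\<forall>\<^sub>F n in sequentially.
        norm (\<epsilon> n) \<ge> c * norm (ln (real n) powr (6/5) / real n powr (1/5))"
      using assms(5) by (auto elim!: landau_omega.bigE)
    \<comment> \<open>The unknown constant behind \<Omega> is absorbed by the diverging logarithmic
      factor, which leaves the clean bound \<epsilon> \<ge> n powr (- 1/5).\<close>
    have "filterlim (\<lambda>n. ln (real n) powr (6/5)) at_top sequentially" by real_asymp
    then have "\<forall>\<^sub>F n in sequentially. 1 / c \<le> ln (real n) powr (6/5)"
      by (simp add: filterlim_at_top)
    with c(2) have \<epsilon>: "\<forall>\<^sub>F n in sequentially. real n powr (- 1 / 5) \<le> \<epsilon> n"
    proof eventually_elim
      case (elim n)
      have "1 / real n powr (1/5) \<le> (c * ln (real n) powr (6/5)) / real n powr (1/5)"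
        using elim(2) c(1) by (intro divide_right_mono) (simp_all add: field_simps)
      also have "\<dots> \<le> \<epsilon> n" using elim(1) assms(1)[of n] by simp
      finally show ?case by (simp add: powr_minus_divide)
    qed
    have "\<forall>\<^sub>F n in sequentially. (14 + log 2 (real n))\<^sup>2 * real n powr (- 9 / 20) \<le> 1"
      and "\<forall>\<^sub>F n in sequentially. 1 / real n \<le> real n powr (- 9 / 20)"
      and "\<forall>\<^sub>F n in sequentially. 192 * real n powr (- 1 / 20) \<le> 1 / 250 * real n powr (- 1 / 40)"
      and "\<forall>\<^sub>F n in sequentially. 4 / real n \<le> real n powr (- 1 / 5)"
      and "\<forall>\<^sub>F n in sequentially. 3 * (14 + log 2 (real n)) * exp (- 2 * real n powr (1 / 10)) +
        (exp (- sqrt (real n) / 3) + real n powr (- 1 / 2)) \<le> real n powr (- 1 / 4)"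
      by real_asymp+
    with \<epsilon> eventually_gt_at_top[of "0::nat"] show ?thesis
    proof eventually_elim
      case (elim n)
      show ?case
      proof (cases "\<epsilon> n < 1 / 2")
        case True
        then show ?thesis
          using parameters.mean_gossip_solves_mean[OF parameters[OF elim(2) True] elim(1,3-7) L]
          by (simp add: A_def)
      next
        case False
        then show ?thesis
          using elim(2) assms(3)[of n] by (simp add: A_def constant_algorithm_solves_mean)
      qed
    qed
  qed
  ultimately show ?thesis by (intro exI[of _ A] conjI exI[of _ L] allI exI[of _ "1 / 4"]) auto
qed

end
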